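(* There is an absolute constant $C>0$ and an online algorithm such that the following holds for all $d,t\ge1$ and $\delta\in(0,1)$. Let $\mathfrak{p}$ be a known probability distribution on $[0,1]^d$ and let $x_1,\dots,x_t$ be drawn from $\mathfrak{p}$ and revealed one at a time; upon seeing $x_i$ the algorithm chooses $\varepsilon_i\in\{-1,1\}$. Then with probability at least $1-\delta$, for all intervals $I\subseteq[0,1]$, all $i\in[t]$ and all $k\in[d]$, \[\mathrm{disc}_I^i(k):=\Big|\sum_{j=1}^i\varepsilon_j 1_I(x_j(k))\Big|\le C\sqrt d\,\log^2(dt/\delta).\]
   Context: $x_j(k)$ is the $k$-th coordinate of $x_j$, and $1_I$ is the indicator function of $I$. The points $x_1,\dots,x_t$ are drawn from $\mathfrak{p}$ (independently), and the algorithm's choice of $\varepsilon_i$ may depend on $\mathfrak{p}$, $x_1,\dots,x_i$ and its own randomness.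
   Formalization: The formal theorem assumes dt/δ ≥ 2, excluding only d = t = 1 with δ > 1/2: there the interval [0,1] always has discrepancy 1 while log²(1/δ) tends to 0 as δ tends to 1, so no absolute constant C could work. *)

theory Defs
  imports "HOL-Probability.Probability"
begin

text \<open>
  The dimension is a variable of the statement, so a point of the unit cube is an extensional
  function on the coordinate set \<open>{1..d}\<close>; the product sigma-algebra below is the Borel
  sigma-algebra of the cube.
\<close>

definition unit_cube :: "nat \<Rightarrow> (nat \<Rightarrow> real) measure" where
  "unit_cube d = PiM {1..d} (\<lambda>_. restrict_space borel {0..1})"

definition cube_distribution :: "nat \<Rightarrow> (nat \<Rightarrow> real) measure \<Rightarrow> bool" where
  "cube_distribution d p \<longleftrightarrow> prob_space p \<and> sets p = sets (unit_cube d)"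

text \<open>The algorithm's own randomness: an infinite sequence of independent uniform reals.\<close>

definition coins :: "(nat \<Rightarrow> real) measure" where
  "coins = PiM UNIV (\<lambda>_. uniform_measure lborel {0..1})"

text \<open>
  The input and the randomness are independent: \<open>x i\<close> is the \<open>i\<close>-th point, so that
  \<open>x i k\<close> is its \<open>k\<close>-th coordinate.
\<close>

definition run_space :: "(nat \<Rightarrow> real) measure \<Rightarrow> nat
    \<Rightarrow> ((nat \<Rightarrow> nat \<Rightarrow> real) \<times> (nat \<Rightarrow> real)) measure" where
  "run_space p t = PiM {1..t} (\<lambda>_. p) \<Otimes>\<^sub>M coins"

type_synonym strategy = "nat \<Rightarrow> (nat \<Rightarrow> nat \<Rightarrow> real) \<times> (nat \<Rightarrow> real) \<Rightarrow> real"

text \<open>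
  The \<open>i\<close>-th decision is a measurable function of the first \<open>i\<close> points and the randomness only:
  its domain consists of the histories indexed by \<open>{1..i}\<close>.
\<close>

definition online_strategy :: "(nat \<Rightarrow> real) measure \<Rightarrow> nat \<Rightarrow> strategy \<Rightarrow> bool" where
  "online_strategy p t A \<longleftrightarrow>
     (\<forall>i\<in>{1..t}. A i \<in> run_space p i \<rightarrow>\<^sub>M count_space {-1, 1})"

definition chosen_sign ::
    "strategy \<Rightarrow> (nat \<Rightarrow> nat \<Rightarrow> real) \<Rightarrow> (nat \<Rightarrow> real) \<Rightarrow> nat \<Rightarrow> real" where
  "chosen_sign A x \<omega> i = A i (restrict x {1..i}, \<omega>)"

definition disc :: "(nat \<Rightarrow> real) \<Rightarrow> (nat \<Rightarrow> nat \<Rightarrow> real) \<Rightarrow> real set \<Rightarrow> nat \<Rightarrow> nat \<Rightarrow> real" where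
  "disc \<epsilon> x I i k = \<bar>\<Sum>j=1..i. \<epsilon> j * indicator I (x j k)\<bar>"

text \<open>
  When \<open>d = t = 1\<close>, the interval \<open>[0,1]\<close> always has discrepancy 1, whereas
  \<open>ln (d * t / \<delta>)\<close> tends to 0 as \<open>\<delta>\<close> tends to 1, so no constant can work for all
  \<open>\<delta> < 1\<close>. The theorem therefore assumes \<open>d * t / \<delta> \<ge> 2\<close>, which is automatic
  unless \<open>d = t = 1\<close> and \<open>\<delta> > 1/2\<close>.
\<close>

end

theory Submission imports Defs begin

text \<open>
  Give every coordinate a monotone cell number such that two different samples share a cell only with
  probability \<open>1 / M\<close>; then with high probability intervals of sample points are intervals of cells.
  A sample is encoded as the unit vector listing, for each coordinate and each of \<open>H\<close> dyadic levels,
  the block containing its cell. The signs come from the self-balancing walk: if \<open>w\<close> is the current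
  signed sum and \<open>v\<close> the new vector, choose \<open>+1\<close> with probability \<open>1/2 - \<langle>w, v\<rangle> / (2 \<kappa>)\<close>. Hoeffding's lemma
  for one step moves the test vector \<open>u\<close> to \<open>u - (\<langle>v, u\<rangle> / \<kappa>) v\<close>, whose norm loss pays for
  the variance of the step, so inductively \<open>E (exp \<langle>w, u\<rangle>) \<le> exp (\<kappa> \<parallel>u\<parallel>\<^sup>2 / 2)\<close>. A prefix of
  cells is a sum of at most \<open>H\<close> dyadic blocks, and \<open>\<kappa>\<close>, \<open>H\<close> are of order \<open>L = ln (d t / \<delta>)\<close>, hence the
  discrepancy is of order \<open>sqrt (d H) * sqrt (\<kappa> H L)\<close>, which is \<open>sqrt d * L\<^sup>2\<close>.
\<close>

subsection \<open>The self-balancing walk\<close>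

text \<open>Hoeffding's lemma for a sign that is \<open>1\<close> with probability \<open>q\<close>,
  hence of mean \<open>2 * q - 1\<close>; values in a range of length 2 give the variance term
  \<open>s\<^sup>2 / 2\<close>.\<close>

lemma two_point_mgf_le:
  fixes q s :: real
  assumes "0 \<le> q" "q \<le> 1"
  shows "q * exp s + (1 - q) * exp (- s) \<le> exp (s\<^sup>2 / 2 + s * (2 * q - 1))"
proof -
  have *: "q * exp s + (1 - q) * exp (- s) \<le> exp (s\<^sup>2 / 2 + s * (2 * q - 1))"
    if "0 \<le> q" "q \<le> 1" "0 \<le> s" for q s :: real
  proof -
    have pos: "1 + q * (exp (2 * s) - 1) > 0"
      using that by (smt (verit) mult_nonneg_nonneg one_le_exp_iff)
    \<comment> \<open>The auxiliary bound concerns a variable with values 0 and 1. A sign is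
      \<open>2 * b - 1\<close> for such a variable \<open>b\<close>, hence the argument
      \<open>2 * s\<close>.\<close>
    have "- (2 * s) * q + ln (1 + q * (exp (2 * s) - 1)) \<le> (2 * s)\<^sup>2 / 8"
      using Hoeffdings_lemma_aux[of "2 * s" q] that by simp
    hence "ln (1 + q * (exp (2 * s) - 1)) \<le> s\<^sup>2 / 2 + 2 * s * q"
      by (simp add: power2_eq_square)
    hence "1 + q * (exp (2 * s) - 1) \<le> exp (s\<^sup>2 / 2 + 2 * s * q)"
      using pos by (metis exp_le_cancel_iff exp_ln)
    hence "exp (- s) * (1 + q * (exp (2 * s) - 1)) \<le> exp (- s) * exp (s\<^sup>2 / 2 + 2 * s * q)"
      by simp
    also have "exp (- s) * exp (s\<^sup>2 / 2 + 2 * s * q) = exp (s\<^sup>2 / 2 + s * (2 * q - 1))"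
      by (simp add: algebra_simps flip: exp_add)
    also have "exp (- s) * (1 + q * (exp (2 * s) - 1)) = q * exp s + (1 - q) * exp (- s)"
      by (simp add: algebra_simps flip: exp_add)
    finally show ?thesis .
  qed
  show ?thesis
  proof (cases "s \<ge> 0")
    case False
    \<comment> \<open>Exchanging the two signs replaces \<open>q\<close> by \<open>1 - q\<close> and
      \<open>s\<close> by \<open>- s\<close>.\<close>
    with *[of "1 - q" "- s"] assms show ?thesis by (simp add: algebra_simps)
  qed (use * assms in blast)
qed

text \<open>
  The value outside \<open>\<bar>g\<bar> \<le> \<kappa>\<close> is not a sign: it is the mean that the biased coin would have,
  so that the moment generating function bound holds without conditioning on \<open>\<bar>g\<bar> \<le> \<kappa>\<close>.
\<close>

definition walk_step :: "real \<Rightarrow> real \<Rightarrow> real \<Rightarrow> real" where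
  "walk_step \<kappa> g r =
     (if \<bar>g\<bar> \<le> \<kappa> then if r \<le> 1/2 - g / (2 * \<kappa>) then 1 else -1 else - g / \<kappa>)"

text \<open>\<open>K\<close> stands for the Gram matrix of the vectors, so the sum is the inner
  product of the current signed sum with the \<open>i\<close>-th vector. The coin
  \<open>\<omega> i\<close> is the fresh randomness of step \<open>i\<close>.\<close>

fun walk :: "(nat \<Rightarrow> nat \<Rightarrow> real) \<Rightarrow> real \<Rightarrow> (nat \<Rightarrow> real) \<Rightarrow> nat \<Rightarrow> real" where
  "walk K \<kappa> \<omega> i = walk_step \<kappa> (\<Sum>j\<in>{1..<i}. walk K \<kappa> \<omega> j * K j i) (\<omega> i)"

declare walk.simps [simp del]

definition drift :: "(nat \<Rightarrow> nat \<Rightarrow> real) \<Rightarrow> real \<Rightarrow> (nat \<Rightarrow> real) \<Rightarrow> nat \<Rightarrow> real" where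
  "drift K \<kappa> \<omega> i = (\<Sum>j\<in>{1..<i}. walk K \<kappa> \<omega> j * K j i)"

lemma walk_eq_step: "walk K \<kappa> \<omega> i = walk_step \<kappa> (drift K \<kappa> \<omega> i) (\<omega> i)"
  by (subst walk.simps) (simp add: drift_def)

text \<open>Unfolding the recursion never reaches a coin or a vector beyond \<open>i\<close>. This
  makes the walk online and later lets finitely many coins replace the infinite sequence.\<close>

lemma walk_cong:
  assumes "\<And>j. 1 \<le> j \<Longrightarrow> j \<le> i \<Longrightarrow> \<omega> j = \<omega>' j"
    and "\<And>j l. 1 \<le> j \<Longrightarrow> j < l \<Longrightarrow> l \<le> i \<Longrightarrow> K j l = K' j l"
    and "1 \<le> i"
  shows "walk K \<kappa> \<omega> i = walk K' \<kappa> \<omega>' i"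
  using assms
proof (induction i rule: less_induct)
  case (less i)
  have "walk K \<kappa> \<omega> j = walk K' \<kappa> \<omega>' j" if "j \<in> {1..<i}" for j
    using that by (intro less.IH) (auto intro!: less.prems)
  thus ?case
    using less.prems by (subst (1 2) walk.simps) (auto intro!: arg_cong2[where f = "walk_step \<kappa>"] sum.cong)
qed

text \<open>The coin \<open>\<omega> i\<close> is not among those read: given the past, step
  \<open>i\<close> combines a fixed drift with a fresh coin.\<close>

lemma drift_cong:
  assumes "\<And>j. 1 \<le> j \<Longrightarrow> j < i \<Longrightarrow> \<omega> j = \<omega>' j"
    and "\<And>j l. 1 \<le> j \<Longrightarrow> j < l \<Longrightarrow> l \<le> i \<Longrightarrow> K j l = K' j l"
  shows "drift K \<kappa> \<omega> i = drift K' \<kappa> \<omega>' i"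
  unfolding drift_def
proof (rule sum.cong)
  fix j assume j: "j \<in> {1..<i}"
  have "walk K \<kappa> \<omega> j = walk K' \<kappa> \<omega>' j"
    by (rule walk_cong) (use j assms in auto)
  thus "walk K \<kappa> \<omega> j * K j i = walk K' \<kappa> \<omega>' j * K' j i"
    using j assms(2) by auto
qed simp

lemma walk_measurable:
  assumes K: "\<And>j l. 1 \<le> j \<Longrightarrow> j < l \<Longrightarrow> l \<le> n \<Longrightarrow> (\<lambda>z. K z j l) \<in> borel_measurable M"
    and \<omega>: "\<And>j. 1 \<le> j \<Longrightarrow> j \<le> n \<Longrightarrow> (\<lambda>z. \<omega> z j) \<in> borel_measurable M"
    and "1 \<le> i" "i \<le> n"
  shows "(\<lambda>z. walk (K z) \<kappa> (\<omega> z) i) \<in> borel_measurable M"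
  using assms(3,4)
proof (induction i rule: less_induct)
  case (less i)
  have [measurable]: "(\<lambda>z. walk (K z) \<kappa> (\<omega> z) j) \<in> borel_measurable M" if "j \<in> {1..<i}" for j
    using that less by auto
  have [measurable]: "(\<lambda>z. K z j i) \<in> borel_measurable M" if "j \<in> {1..<i}" for j
    using that less by (auto intro!: K)
  have [measurable]: "(\<lambda>z. \<omega> z i) \<in> borel_measurable M"
    using less by (auto intro!: \<omega>)
  show ?case
    by (subst walk.simps, unfold walk_step_def) measurable
qed

lemma drift_measurable:
  assumes K: "\<And>j l. 1 \<le> j \<Longrightarrow> j < l \<Longrightarrow> l \<le> n \<Longrightarrow> (\<lambda>z. K z j l) \<in> borel_measurable M"
    and \<omega>: "\<And>j. 1 \<le> j \<Longrightarrow> j \<le> n \<Longrightarrow> (\<lambda>z. \<omega> z j) \<in> borel_measurable M"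
    and "i \<le> n"
  shows "(\<lambda>z. drift (K z) \<kappa> (\<omega> z) i) \<in> borel_measurable M"
proof -
  have [measurable]: "(\<lambda>z. walk (K z) \<kappa> (\<omega> z) j) \<in> borel_measurable M" if "j \<in> {1..<i}" for j
    using that assms by (intro walk_measurable[of n]) auto
  have [measurable]: "(\<lambda>z. K z j i) \<in> borel_measurable M" if "j \<in> {1..<i}" for j
    using that assms(3) by (auto intro!: K)
  show ?thesis unfolding drift_def by measurable
qed

abbreviation unif :: "real measure" where
  "unif \<equiv> uniform_measure lborel {0..1}"

lemma prob_space_unif: "prob_space unif"
  by (rule prob_space_uniform_measure) auto

text \<open>The step has mean \<open>- g / \<kappa>\<close> in both branches. A random sign costs
  the extra \<open>s\<^sup>2 / 2\<close> of Hoeffding's lemma; the deterministic fallback costs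
  nothing.\<close>

lemma nn_integral_walk_step_le:
  fixes g s \<kappa> :: real
  assumes "\<kappa> > 0"
  shows "(\<integral>\<^sup>+r. exp (walk_step \<kappa> g r * s) \<partial>unif) \<le> ennreal (exp (s\<^sup>2 / 2 - s * g / \<kappa>))"
proof (cases "\<bar>g\<bar> \<le> \<kappa>")
  case True
  define q where "q = 1/2 - g / (2 * \<kappa>)"
  have q: "0 \<le> q" "q \<le> 1"
    using True assms by (auto simp: q_def field_simps abs_le_iff)
  interpret U: prob_space unif by (rule prob_space_unif)
  have S: "{..q} \<in> sets unif" "{q<..} \<in> sets unif" by simp_all
  have A: "emeasure unif {..q} = ennreal q"
  proof -
    have "{0..1} \<inter> {..q} = {0..q}" using q by auto
    thus ?thesis using q by (subst emeasure_uniform_measure) (auto simp: divide_ennreal_def)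
  qed
  have B: "emeasure unif {q<..} = ennreal (1 - q)"
  proof -
    have "{0..1} \<inter> {q<..} = {q<..1}" using q by auto
    thus ?thesis using q by (subst emeasure_uniform_measure) (auto simp: divide_ennreal_def)
  qed
  have "(\<integral>\<^sup>+r. exp (walk_step \<kappa> g r * s) \<partial>unif) =
        (\<integral>\<^sup>+r. ennreal (exp s) * indicator {..q} r + ennreal (exp (- s)) * indicator {q<..} r \<partial>unif)"
    by (intro nn_integral_cong) (auto simp: walk_step_def True q_def indicator_def)
  also have "\<dots> = ennreal (exp s) * ennreal q + ennreal (exp (- s)) * ennreal (1 - q)"
    by (subst nn_integral_add, simp, simp)
      (simp only: nn_integral_cmult_indicator[OF S(1)] nn_integral_cmult_indicator[OF S(2)] A B)
  also have "\<dots> = ennreal (q * exp s + (1 - q) * exp (- s))"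
    using q by (subst ennreal_plus) (simp_all add: ennreal_mult mult.commute)
  also have "\<dots> \<le> ennreal (exp (s\<^sup>2 / 2 + s * (2 * q - 1)))"
    by (intro ennreal_leI two_point_mgf_le q)
  also have "s\<^sup>2 / 2 + s * (2 * q - 1) = s\<^sup>2 / 2 - s * g / \<kappa>"
    using assms by (simp add: q_def field_simps)
  finally show ?thesis .
next
  case False
  interpret U: prob_space unif by (rule prob_space_unif)
  have "(\<integral>\<^sup>+r. exp (walk_step \<kappa> g r * s) \<partial>unif) = ennreal (exp (- s * g / \<kappa>))"
    using False U.emeasure_space_1 by (simp add: walk_step_def mult.commute)
  also have "\<dots> \<le> ennreal (exp (s\<^sup>2 / 2 - s * g / \<kappa>))"
    by (intro ennreal_leI) simp
  finally show ?thesis .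
qed

section \<open>Exponential moments of the walk\<close>

definition dotp :: "'b set \<Rightarrow> ('b \<Rightarrow> real) \<Rightarrow> ('b \<Rightarrow> real) \<Rightarrow> real" where
  "dotp B u v = (\<Sum>b\<in>B. u b * v b)"

lemma dotp_diff_scale_right: "dotp B v (\<lambda>b. u b - a * u' b) = dotp B v u - a * dotp B v u'"
  by (simp add: dotp_def sum_subtractf sum_distrib_left algebra_simps)

lemma dotp_diff_scale_left: "dotp B (\<lambda>b. u b - a * u' b) v = dotp B u v - a * dotp B u' v"
  by (simp add: dotp_def sum_subtractf sum_distrib_left algebra_simps)

lemma dotp_commute: "dotp B u v = dotp B v u"
  by (simp add: dotp_def mult.commute)

lemma dotp_scale_right: "dotp B v (\<lambda>b. a * u b) = a * dotp B v u"
  by (simp add: dotp_def sum_distrib_left algebra_simps)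

lemma dotp_self_nonneg: "dotp B u u \<ge> 0"
  by (simp add: dotp_def sum_nonneg)

lemma unif_component_measurable:
  assumes "j \<in> J"
  shows "(\<lambda>\<omega>. \<omega> j) \<in> borel_measurable (PiM J (\<lambda>_. unif))"
proof -
  have "(\<lambda>\<omega>. \<omega> j) \<in> measurable (PiM J (\<lambda>_. unif)) unif"
    using assms by (rule measurable_component_singleton)
  thus ?thesis by (simp cong: measurable_cong_sets)
qed

text \<open>Induction on \<open>n\<close> for all test vectors at once, since integrating out the
  last coin leaves a shorter walk tested against a different vector.\<close>

lemma walk_mgf_le:
  fixes v :: "nat \<Rightarrow> 'b \<Rightarrow> real"
  assumes \<kappa>: "\<kappa> \<ge> 1" and v: "\<And>i. 1 \<le> i \<Longrightarrow> i \<le> n \<Longrightarrow> dotp B (v i) (v i) \<le> 1"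
    and K: "K = (\<lambda>j i. dotp B (v j) (v i))"
  shows "(\<integral>\<^sup>+\<omega>. exp (\<Sum>j=1..n. walk K \<kappa> \<omega> j * dotp B (v j) u) \<partial>PiM {1..n} (\<lambda>_. unif))
           \<le> ennreal (exp (\<kappa> / 2 * dotp B u u))"
  using v
proof (induction n arbitrary: u)
  case 0
  show ?case using \<kappa> dotp_self_nonneg[of B u]
    by (simp add: prob_space.emeasure_space_1[OF prob_space_PiM] prob_space_unif)
next
  case (Suc n)
  interpret U: prob_space unif by (rule prob_space_unif)
  interpret product_sigma_finite "\<lambda>_::nat. unif"
    by unfold_locales
  let ?P = "PiM {1..n} (\<lambda>_. unif)"
  define s where "s = dotp B (v (Suc n)) u"
  \<comment> \<open>The drift is linear in the earlier steps. With this \<open>u'\<close>, the mean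
    \<open>- g / \<kappa>\<close> of the last step, times \<open>s\<close>, is exactly the change
    that replacing \<open>u\<close> by \<open>u'\<close> makes in the earlier terms.\<close>
  define u' where "u' = (\<lambda>b. u b - s / \<kappa> * v (Suc n) b)"
  let ?Z = "\<lambda>\<omega> u. \<Sum>j=1..n. walk K \<kappa> \<omega> j * dotp B (v j) u"
  let ?g = "\<lambda>\<omega>. drift K \<kappa> \<omega> (Suc n)"
  have meas: "(\<lambda>\<omega>. walk K \<kappa> \<omega> j) \<in> borel_measurable (PiM {1..m} (\<lambda>_. unif))"
    if "j \<in> {1..m}" for j m
    by (rule walk_measurable[of m]) (use that in \<open>simp_all add: unif_component_measurable\<close>)
  have measZ: "(\<lambda>\<omega>. ?Z \<omega> w) \<in> borel_measurable ?P" for w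
    using meas by measurable
  have ins: "{1..Suc n} = insert (Suc n) {1..n}"
    by auto
  have split: "(\<Sum>j=1..Suc n. walk K \<kappa> (x(Suc n := y)) j * dotp B (v j) u)
      = ?Z x u + walk_step \<kappa> (?g x) y * s" for x y
  proof -
    have 1: "walk K \<kappa> (x(Suc n := y)) j = walk K \<kappa> x j" if "j \<in> {1..n}" for j
      by (rule walk_cong) (use that in auto)
    have "drift K \<kappa> (x(Suc n := y)) (Suc n) = ?g x"
      by (rule drift_cong) auto
    hence "walk K \<kappa> (x(Suc n := y)) (Suc n) = walk_step \<kappa> (?g x) y"
      by (subst walk_eq_step) simp
    with 1 show ?thesis by (simp add: s_def)
  qed
  have drift: "?Z x u - s * ?g x / \<kappa> = ?Z x u'" for x
  proof -
    have "dotp B (v j) u' = dotp B (v j) u - s / \<kappa> * K j (Suc n)" for j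
      by (simp only: u'_def dotp_diff_scale_right K)
    hence "?Z x u' = ?Z x u - (\<Sum>j=1..n. s / \<kappa> * (walk K \<kappa> x j * K j (Suc n)))"
      by (simp add: right_diff_distrib sum_subtractf mult.left_commute mult.assoc)
    thus ?thesis
      by (simp add: drift_def atLeastLessThanSuc_atLeastAtMost sum_distrib_left sum_divide_distrib)
  qed
  \<comment> \<open>The shorter test vector pays for the variance: the loss of squared norm, times
    \<open>\<kappa> / 2\<close>, is at least \<open>s\<^sup>2 - s\<^sup>2 / (2 * \<kappa>)\<close>,
    which is at least \<open>s\<^sup>2 / 2\<close> because \<open>\<kappa> \<ge> 1\<close>.\<close>
  have u': "s\<^sup>2 / 2 + \<kappa> / 2 * dotp B u' u' \<le> \<kappa> / 2 * dotp B u u"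
  proof -
    have "dotp B u' u' = dotp B u u - 2 * s\<^sup>2 / \<kappa> + s\<^sup>2 / \<kappa>\<^sup>2 * dotp B (v (Suc n)) (v (Suc n))"
      unfolding u'_def dotp_diff_scale_left dotp_diff_scale_right
      by (simp add: s_def dotp_commute[of B u "v (Suc n)"] power2_eq_square algebra_simps)
    also have "\<dots> \<le> dotp B u u - 2 * s\<^sup>2 / \<kappa> + s\<^sup>2 / \<kappa>\<^sup>2 * 1"
      using Suc.prems[of "Suc n"] by (intro add_left_mono mult_left_mono) auto
    finally have "\<kappa> / 2 * dotp B u' u' \<le> \<kappa> / 2 * (dotp B u u - 2 * s\<^sup>2 / \<kappa> + s\<^sup>2 / \<kappa>\<^sup>2 * 1)"
      using \<kappa> by (intro mult_left_mono) auto
    also have "\<dots> = \<kappa> / 2 * dotp B u u - s\<^sup>2 + s\<^sup>2 / (2 * \<kappa>)"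
      using \<kappa> by (simp add: field_simps power2_eq_square)
    also have "s\<^sup>2 / (2 * \<kappa>) \<le> s\<^sup>2 / 2"
      using \<kappa> by (intro divide_left_mono) auto
    finally show ?thesis by simp
  qed
  have "(\<integral>\<^sup>+\<omega>. exp (\<Sum>j=1..Suc n. walk K \<kappa> \<omega> j * dotp B (v j) u) \<partial>PiM {1..Suc n} (\<lambda>_. unif))
      = (\<integral>\<^sup>+x. \<integral>\<^sup>+y. ennreal (exp (\<Sum>j=1..Suc n. walk K \<kappa> (x(Suc n := y)) j * dotp B (v j) u))
           \<partial>unif \<partial>?P)"
    unfolding ins
  proof (subst product_nn_integral_insert)
    show "(\<lambda>\<omega>. ennreal (exp (\<Sum>j\<in>insert (Suc n) {1..n}. walk K \<kappa> \<omega> j * dotp B (v j) u)))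
        \<in> borel_measurable (PiM (insert (Suc n) {1..n}) (\<lambda>_. unif))"
      unfolding ins[symmetric] using meas[of _ "Suc n"] by measurable
  qed auto
  also have "\<dots> \<le> (\<integral>\<^sup>+x. ennreal (exp (s\<^sup>2 / 2)) * ennreal (exp (?Z x u')) \<partial>?P)"
  proof (rule nn_integral_mono)
    fix x
    have "(\<integral>\<^sup>+y. ennreal (exp (\<Sum>j=1..Suc n. walk K \<kappa> (x(Suc n := y)) j * dotp B (v j) u)) \<partial>unif)
        = (\<integral>\<^sup>+y. ennreal (exp (?Z x u)) * ennreal (exp (walk_step \<kappa> (?g x) y * s)) \<partial>unif)"
      unfolding split by (simp add: exp_add ennreal_mult)
    also have "\<dots> = ennreal (exp (?Z x u)) * (\<integral>\<^sup>+y. ennreal (exp (walk_step \<kappa> (?g x) y * s)) \<partial>unif)"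
      by (intro nn_integral_cmult) (simp add: walk_step_def)
    also have "\<dots> \<le> ennreal (exp (?Z x u)) * ennreal (exp (s\<^sup>2 / 2 - s * ?g x / \<kappa>))"
      using \<kappa> by (intro mult_left_mono nn_integral_walk_step_le) auto
    also have "\<dots> = ennreal (exp (s\<^sup>2 / 2) * exp (?Z x u - s * ?g x / \<kappa>))"
      by (simp add: ennreal_mult[symmetric] algebra_simps flip: exp_add)
    also have "\<dots> = ennreal (exp (s\<^sup>2 / 2)) * ennreal (exp (?Z x u'))"
      unfolding drift by (simp add: ennreal_mult)
    finally show "(\<integral>\<^sup>+y. ennreal (exp (\<Sum>j=1..Suc n. walk K \<kappa> (x(Suc n := y)) j * dotp B (v j) u)) \<partial>unif)
        \<le> ennreal (exp (s\<^sup>2 / 2)) * ennreal (exp (?Z x u'))" .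
  qed
  also have "\<dots> = ennreal (exp (s\<^sup>2 / 2)) * (\<integral>\<^sup>+x. exp (?Z x u') \<partial>?P)"
    by (rule nn_integral_cmult) (use measZ in measurable)
  also have "\<dots> \<le> ennreal (exp (s\<^sup>2 / 2)) * ennreal (exp (\<kappa> / 2 * dotp B u' u'))"
    using Suc.prems by (intro mult_left_mono Suc.IH) auto
  also have "\<dots> = ennreal (exp (s\<^sup>2 / 2 + \<kappa> / 2 * dotp B u' u'))"
    by (simp add: exp_add ennreal_mult)
  also have "\<dots> \<le> ennreal (exp (\<kappa> / 2 * dotp B u u))"
    using u' by (intro ennreal_leI) simp
  finally show ?case .
qed

section \<open>Passage to the infinite coin sequence, and tail bounds\<close>

lemma product_prob_space_unif: "product_prob_space (\<lambda>_::nat. unif)"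
  by (intro product_prob_space.intro product_sigma_finite.intro product_prob_space_axioms.intro
      prob_space_unif prob_space_imp_sigma_finite)

lemma prob_space_coins: "prob_space coins"
  unfolding coins_def by (intro prob_space_PiM prob_space_unif)

lemma coins_component_measurable [simp]: "(\<lambda>\<omega>. \<omega> i) \<in> borel_measurable coins"
  unfolding coins_def by (rule unif_component_measurable) simp

lemma walk_mgf_coins_le:
  fixes v :: "nat \<Rightarrow> 'b \<Rightarrow> real"
  assumes \<kappa>: "\<kappa> \<ge> 1" and v: "\<And>i. 1 \<le> i \<Longrightarrow> i \<le> n \<Longrightarrow> dotp B (v i) (v i) \<le> 1"
    and K: "K = (\<lambda>j i. dotp B (v j) (v i))"
  shows "(\<integral>\<^sup>+\<omega>. exp (\<Sum>j=1..n. walk K \<kappa> \<omega> j * dotp B (v j) u) \<partial>coins)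
           \<le> ennreal (exp (\<kappa> / 2 * dotp B u u))"
proof -
  interpret product_prob_space "\<lambda>_::nat. unif" UNIV by (rule product_prob_space_unif)
  let ?P = "PiM {1..n} (\<lambda>_. unif)"
  let ?f = "\<lambda>\<omega>. ennreal (exp (\<Sum>j=1..n. walk K \<kappa> \<omega> j * dotp B (v j) u))"
  have meas: "(\<lambda>\<omega>. walk K \<kappa> \<omega> j) \<in> borel_measurable ?P" if "j \<in> {1..n}" for j
    by (rule walk_measurable[of n]) (use that in \<open>simp_all add: unif_component_measurable\<close>)
  have "?f \<in> borel_measurable ?P"
    using meas by measurable
  moreover have P: "distr coins ?P (\<lambda>\<omega>. restrict \<omega> {1..n}) = ?P"
    unfolding coins_def by (rule distr_PiM_restrict_finite) auto
  moreover have "(\<lambda>\<omega>. restrict \<omega> {1..n}) \<in> measurable coins ?P"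
    unfolding coins_def by (rule measurable_restrict_subset) auto
  ultimately have "(\<integral>\<^sup>+\<omega>. ?f \<omega> \<partial>?P) = (\<integral>\<^sup>+\<omega>. ?f (restrict \<omega> {1..n}) \<partial>coins)"
    using nn_integral_distr[of "\<lambda>\<omega>. restrict \<omega> {1..n}" coins ?P ?f] by (simp only: P)
  also have "\<dots> = (\<integral>\<^sup>+\<omega>. ?f \<omega> \<partial>coins)"
  proof (intro nn_integral_cong)
    fix \<omega>
    have "walk K \<kappa> (restrict \<omega> {1..n}) j = walk K \<kappa> \<omega> j" if "j \<in> {1..n}" for j
      by (rule walk_cong) (use that in auto)
    thus "?f (restrict \<omega> {1..n}) = ?f \<omega>"
      by simp
  qed
  finally show ?thesis
    using walk_mgf_le[OF \<kappa> v K, of n u] by simp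
qed

lemma walk_tail_le:
  fixes v :: "nat \<Rightarrow> 'b \<Rightarrow> real"
  assumes \<kappa>: "\<kappa> \<ge> 1" and v: "\<And>i. 1 \<le> i \<Longrightarrow> i \<le> n \<Longrightarrow> dotp B (v i) (v i) \<le> 1"
    and K: "K = (\<lambda>j i. dotp B (v j) (v i))"
    and u: "dotp B u u \<le> N" and N: "N > 0" and lam: "l > 0"
  shows "measure coins {\<omega> \<in> space coins. \<bar>\<Sum>j=1..n. walk K \<kappa> \<omega> j * dotp B (v j) u\<bar> > l}
           \<le> 2 * exp (- l\<^sup>2 / (2 * \<kappa> * N))"
proof -
  interpret prob_space coins by (rule prob_space_coins)
  let ?Z = "\<lambda>\<omega> u. \<Sum>j=1..n. walk K \<kappa> \<omega> j * dotp B (v j) u"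
  have meas [measurable]: "(\<lambda>\<omega>. walk K \<kappa> \<omega> j) \<in> borel_measurable coins" if "j \<in> {1..n}" for j
    by (rule walk_measurable[of n]) (use that in \<open>simp_all add: unif_component_measurable\<close>)
  \<comment> \<open>This value minimizes the Chernoff exponent
    \<open>\<kappa> / 2 * (\<theta>\<^sup>2 * N) - \<theta> * l\<close>.\<close>
  define \<theta> where "\<theta> = l / (\<kappa> * N)"
  have \<theta>: "\<theta> > 0" using assms by (simp add: \<theta>_def)
  have one: "measure coins {\<omega> \<in> space coins. ?Z \<omega> u \<ge> l} \<le> exp (- l\<^sup>2 / (2 * \<kappa> * N))"
    if u: "dotp B u u \<le> N" for u
  proof -
    have "emeasure coins {\<omega> \<in> space coins. ?Z \<omega> u \<ge> l} \<le>
        ennreal (exp (- \<theta> * l)) * (\<integral>\<^sup>+\<omega>. ennreal (exp (\<theta> * ?Z \<omega> u)) * indicator (space coins) \<omega> \<partial>coins)"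
      by (rule Chernoff_ineq_nn_integral_ge[OF \<theta>]) auto
    also have "(\<integral>\<^sup>+\<omega>. ennreal (exp (\<theta> * ?Z \<omega> u)) * indicator (space coins) \<omega> \<partial>coins)
        = (\<integral>\<^sup>+\<omega>. ennreal (exp (?Z \<omega> (\<lambda>b. \<theta> * u b))) \<partial>coins)"
      by (intro nn_integral_cong) (simp add: dotp_scale_right sum_distrib_left algebra_simps)
    also have "\<dots> \<le> ennreal (exp (\<kappa> / 2 * dotp B (\<lambda>b. \<theta> * u b) (\<lambda>b. \<theta> * u b)))"
      by (rule walk_mgf_coins_le[OF \<kappa> v K])
    also have "dotp B (\<lambda>b. \<theta> * u b) (\<lambda>b. \<theta> * u b) = \<theta>\<^sup>2 * dotp B u u"
      by (simp add: dotp_def sum_distrib_left power2_eq_square algebra_simps)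
    also have "exp (\<kappa> / 2 * (\<theta>\<^sup>2 * dotp B u u)) \<le> exp (\<kappa> / 2 * (\<theta>\<^sup>2 * N))"
      using \<kappa> u by (simp add: mult_left_mono)
    finally have "emeasure coins {\<omega> \<in> space coins. ?Z \<omega> u \<ge> l} \<le>
        ennreal (exp (- \<theta> * l) * exp (\<kappa> / 2 * (\<theta>\<^sup>2 * N)))"
      by (simp add: ennreal_mult mult_left_mono ennreal_leI)
    also have "exp (- \<theta> * l) * exp (\<kappa> / 2 * (\<theta>\<^sup>2 * N)) = exp (- l\<^sup>2 / (2 * \<kappa> * N))"
      using \<kappa> N by (simp add: \<theta>_def power2_eq_square field_simps flip: exp_add)
    finally show ?thesis
      by (simp add: emeasure_eq_measure)
  qed
  \<comment> \<open>The lower tail is the upper tail for the negated test vector, which has the same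
    norm.\<close>
  have neg: "?Z \<omega> (\<lambda>b. - u b) = - ?Z \<omega> u" for \<omega>
    by (simp add: dotp_def sum_negf)
  have "measure coins {\<omega> \<in> space coins. \<bar>?Z \<omega> u\<bar> > l}
      \<le> measure coins ({\<omega> \<in> space coins. ?Z \<omega> u \<ge> l} \<union> {\<omega> \<in> space coins. ?Z \<omega> (\<lambda>b. - u b) \<ge> l})"
    by (rule finite_measure_mono) (auto simp: neg simp del: One_nat_def)
  also have "\<dots> \<le> measure coins {\<omega> \<in> space coins. ?Z \<omega> u \<ge> l} +
      measure coins {\<omega> \<in> space coins. ?Z \<omega> (\<lambda>b. - u b) \<ge> l}"
    by (rule measure_Un_le) auto
  also have "\<dots> \<le> exp (- l\<^sup>2 / (2 * \<kappa> * N)) + exp (- l\<^sup>2 / (2 * \<kappa> * N))"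
    using u by (intro add_mono one) (simp_all add: dotp_def)
  finally show ?thesis by simp
qed

subsection \<open>Dyadic features\<close>

text \<open>In \<open>(k, h, a)\<close>, \<open>k\<close> is a coordinate, \<open>h\<close> a dyadic
  level and \<open>a\<close> the number of the block of cells
  \<open>{a * 2^h..<Suc a * 2^h}\<close>.\<close>

definition nodes :: "nat \<Rightarrow> nat \<Rightarrow> (nat \<times> nat \<times> nat) set" where
  "nodes d H = {1..d} \<times> {..<H} \<times> {..<2^H}"

definition feature :: "nat \<Rightarrow> nat \<Rightarrow> (nat \<Rightarrow> nat) \<Rightarrow> nat \<times> nat \<times> nat \<Rightarrow> real" where
  "feature d H q = (\<lambda>(k, h, a). if a = q k div 2^h then 1 / sqrt (real d * real H) else 0)"

text \<open>Indicator of the dyadic blocks that partition \<open>{..<m}\<close>. If the binary digit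
  of \<open>m\<close> at level \<open>h\<close> is 1, then \<open>m\<close> with its lower digits
  cleared is the right end of a block of length \<open>2^h\<close>, whose number is
  \<open>m div 2^h - 1\<close>.\<close>

definition prefix_vec :: "nat \<Rightarrow> nat \<Rightarrow> nat \<times> nat \<times> nat \<Rightarrow> real" where
  "prefix_vec k0 m = (\<lambda>(k, h, a). if k = k0 \<and> odd (m div 2^h) \<and> Suc a = m div 2^h then 1 else 0)"

definition feature_kernel :: "nat \<Rightarrow> nat \<Rightarrow> (nat \<Rightarrow> nat \<Rightarrow> nat) \<Rightarrow> nat \<Rightarrow> nat \<Rightarrow> real" where
  "feature_kernel d H q j i = dotp (nodes d H) (feature d H (q j)) (feature d H (q i))"

lemma dotp_nodes:
  "dotp (nodes d H) u v = (\<Sum>k=1..d. \<Sum>h<H. \<Sum>a<2^H. u (k, h, a) * v (k, h, a))"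
  by (simp add: dotp_def nodes_def sum.cartesian_product)

text \<open>Each of the \<open>d * H\<close> pairs of coordinate and level has at most one nonzero
  entry, of square \<open>1 / (d * H)\<close>. Equality may fail because \<open>q\<close> is
  arbitrary, so that a block number may leave the index range.\<close>

lemma feature_norm_le:
  "dotp (nodes d H) (feature d H q) (feature d H q) \<le> 1"
proof -
  let ?c = "1 / sqrt (real d * real H)"
  have "dotp (nodes d H) (feature d H q) (feature d H q)
      \<le> (\<Sum>k=1..d. \<Sum>h<H. ?c * ?c)"
    unfolding dotp_nodes
  proof (intro sum_mono)
    fix k h
    have "(\<Sum>a<(2::nat)^H. feature d H q (k, h, a) * feature d H q (k, h, a))
        = (\<Sum>a<(2::nat)^H. if a = q k div 2^h then ?c * ?c else 0)"
      by (intro sum.cong) (auto simp: feature_def)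
    also have "\<dots> \<le> ?c * ?c"
      by (subst sum.delta) auto
    finally show "(\<Sum>a<(2::nat)^H. feature d H q (k, h, a) * feature d H q (k, h, a)) \<le> ?c * ?c" .
  qed
  also have "\<dots> \<le> 1"
  proof -
    have "?c * ?c = 1 / (real d * real H)"
      by (simp only: times_divide_times_eq real_sqrt_mult_self) simp
    thus ?thesis by simp
  qed
  finally show ?thesis .
qed

text \<open>A prefix uses at most one block per level, hence at most \<open>H\<close> entries equal
  to 1.\<close>

lemma prefix_vec_norm_le: "dotp (nodes d H) (prefix_vec k m) (prefix_vec k m) \<le> real H"
proof -
  have "(\<Sum>h<H. \<Sum>a<2^H. prefix_vec k m (l, h, a) * prefix_vec k m (l, h, a))
      \<le> (if l = k then real H else 0)" for l
  proof -
    have "(\<Sum>a<2^H. prefix_vec k m (l, h, a) * prefix_vec k m (l, h, a)) \<le> (if l = k then 1 else 0)" for h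
    proof -
      have "(\<Sum>a<(2::nat)^H. prefix_vec k m (l, h, a) * prefix_vec k m (l, h, a))
          \<le> (\<Sum>a<(2::nat)^H. if a = m div 2^h - 1 then (if l = k then 1 else 0) else 0)"
        by (intro sum_mono) (auto simp: prefix_vec_def)
      also have "\<dots> \<le> (if l = k then 1 else 0)"
        by (subst sum.delta) auto
      finally show ?thesis .
    qed
    hence "(\<Sum>h<H. \<Sum>a<2^H. prefix_vec k m (l, h, a) * prefix_vec k m (l, h, a))
        \<le> (\<Sum>h<H. if l = k then 1 else 0)"
      by (intro sum_mono)
    thus ?thesis by (auto split: if_splits)
  qed
  hence "dotp (nodes d H) (prefix_vec k m) (prefix_vec k m) \<le> (\<Sum>l=1..d. if l = k then real H else 0)"
    unfolding dotp_nodes by (intro sum_mono)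
  also have "\<dots> \<le> real H"
    by (subst sum.delta) auto
  finally show ?thesis .
qed

text \<open>
  The binary digits of \<open>m\<close> split \<open>{..<m}\<close> into dyadic blocks, one for each digit 1.
\<close>

lemma dyadic_prefix_count:
  fixes q m :: nat
  assumes "q < 2^H" "m < 2^H"
  shows "(\<Sum>h<H. if odd (m div 2^h) \<and> Suc (q div 2^h) = m div 2^h then 1 else 0 :: real)
       = (if q < m then 1 else 0)"
  using assms
proof (induction H arbitrary: q m)
  case (Suc H)
  \<comment> \<open>Level 0 treats the last binary digit; the higher levels are the same claim for
    \<open>q div 2\<close> and \<open>m div 2\<close>.\<close>
  have "(\<Sum>h<Suc H. if odd (m div 2^h) \<and> Suc (q div 2^h) = m div 2^h then 1 else 0 :: real)
      = (if odd m \<and> Suc q = m then 1 else 0) +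
        (\<Sum>h<H. if odd (m div 2 div 2^h) \<and> Suc (q div 2 div 2^h) = m div 2 div 2^h then 1 else 0)"
    by (subst sum.lessThan_Suc_shift) (simp add: div_mult2_eq)
  also have "\<dots> = (if odd m \<and> Suc q = m then 1 else 0) + (if q div 2 < m div 2 then 1 else 0)"
    using Suc.prems by (subst Suc.IH) auto
  also have "\<dots> = (if q < m then 1 else 0)"
  proof -
    \<comment> \<open>Either the halves already compare, or \<open>q\<close> is the last number
      below an odd \<open>m\<close>. The two cases exclude each other, so the indicators add
      up.\<close>
    have "q < m \<longleftrightarrow> (odd m \<and> Suc q = m) \<or> q div 2 < m div 2" by presburger
    moreover have "\<not> ((odd m \<and> Suc q = m) \<and> q div 2 < m div 2)" by presburger
    ultimately show ?thesis by auto
  qed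
  finally show ?case .
qed auto

text \<open>Exactly one block of the partition of \<open>{..<m}\<close> contains the cell
  \<open>q k\<close> if \<open>q k < m\<close>, and none otherwise. Tail bounds for inner products
  thereby become bounds for prefix sums of signs.\<close>

lemma dotp_feature_prefix:
  assumes "k \<in> {1..d}" "q k < 2^H" "m < 2^H"
  shows "dotp (nodes d H) (feature d H q) (prefix_vec k m)
       = (if q k < m then 1 else 0) / sqrt (real d * real H)"
proof -
  let ?c = "1 / sqrt (real d * real H)"
  have inner: "(\<Sum>h<H. \<Sum>a<2^H. feature d H q (l, h, a) * prefix_vec k m (l, h, a))
      = (if l = k then (if q k < m then 1 else 0) * ?c else 0)" for l
  proof (cases "l = k")
    case True
    have "(\<Sum>a<2^H. feature d H q (k, h, a) * prefix_vec k m (k, h, a))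
        = (if odd (m div 2^h) \<and> Suc (q k div 2^h) = m div 2^h then 1 else 0) * ?c" for h
    proof -
      have "q k div 2^h < 2^H"
        using assms(2) by (meson div_le_dividend le_less_trans)
      moreover have "(\<Sum>a<2^H. feature d H q (k, h, a) * prefix_vec k m (k, h, a))
          = (\<Sum>a<2^H. if a = q k div 2^h
               then (if odd (m div 2^h) \<and> Suc (q k div 2^h) = m div 2^h then 1 else 0) * ?c else 0)"
        by (intro sum.cong) (auto simp: feature_def prefix_vec_def)
      ultimately show ?thesis
        by (subst (asm) sum.delta) auto
    qed
    thus ?thesis
      using dyadic_prefix_count[OF assms(2,3)] True by (simp flip: sum_divide_distrib)
  qed (simp add: prefix_vec_def)
  show ?thesis
    unfolding dotp_nodes inner using assms(1) by simp
qed

text \<open>The sample is fixed here and only the coins are random. A union bound runs over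
  \<open>t\<close> drifts and \<open>t * d * 2^H\<close> prefix sums.\<close>

lemma walk_prefix_bound:
  fixes q :: "nat \<Rightarrow> nat \<Rightarrow> nat"
  assumes q: "\<And>j k. 1 \<le> j \<Longrightarrow> j \<le> t \<Longrightarrow> k \<in> {1..d} \<Longrightarrow> q j k < 2^H"
    and \<kappa>: "\<kappa> \<ge> 1" and l: "l > 0" and H: "H > 0" and d: "d > 0"
  shows "measure coins {\<omega> \<in> space coins. \<not> (\<forall>i\<in>{1..t}. \<bar>drift (feature_kernel d H q) \<kappa> \<omega> i\<bar> \<le> \<kappa> \<and>
      (\<forall>k\<in>{1..d}. \<forall>m\<in>{..<2^H}.
         \<bar>\<Sum>j=1..i. walk (feature_kernel d H q) \<kappa> \<omega> j * (if q j k < m then 1 else 0)\<bar>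
           \<le> sqrt (real d * real H) * l))}
    \<le> real t * (2 * exp (- \<kappa> / 2)) + real t * (real d * (2^H * (2 * exp (- l\<^sup>2 / (2 * \<kappa> * real H)))))"
proof -
  interpret prob_space coins by (rule prob_space_coins)
  let ?B = "nodes d H" and ?v = "\<lambda>i. feature d H (q i)" and ?K = "feature_kernel d H q"
  have K: "?K = (\<lambda>j i. dotp ?B (?v j) (?v i))"
    by (simp add: feature_kernel_def fun_eq_iff)
  have [measurable]: "(\<lambda>\<omega>. walk ?K \<kappa> \<omega> j) \<in> borel_measurable coins" if "j \<ge> 1" for j
    by (rule walk_measurable[of j]) (use that in auto)
  have [measurable]: "(\<lambda>\<omega>. drift ?K \<kappa> \<omega> j) \<in> borel_measurable coins" for j
    by (rule drift_measurable[of j]) auto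
  define D where "D i = {\<omega> \<in> space coins. \<bar>drift ?K \<kappa> \<omega> i\<bar> > \<kappa>}" for i
  define Z where "Z i k m = {\<omega> \<in> space coins.
      \<bar>\<Sum>j=1..i. walk ?K \<kappa> \<omega> j * (if q j k < m then 1 else 0)\<bar> > sqrt (real d * real H) * l}" for i k m
  have [measurable]: "D i \<in> sets coins" "Z i k m \<in> sets coins" for i k m
    unfolding D_def Z_def by measurable
  have D: "measure coins (D i) \<le> 2 * exp (- \<kappa> / 2)" if "i \<in> {1..t}" for i
  proof -
    from that obtain n where n: "i = Suc n" by (cases i) auto
    \<comment> \<open>The drift is itself an inner product: the walk stopped one step earlier,
      tested against the new feature vector, of norm at most 1. The same tail bound therefore keeps
      it within \<open>\<kappa>\<close>.\<close>
    have eq: "drift ?K \<kappa> \<omega> i = (\<Sum>j=1..n. walk ?K \<kappa> \<omega> j * dotp ?B (?v j) (?v i))" for \<omega>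
      by (simp add: n drift_def feature_kernel_def atLeastLessThanSuc_atLeastAtMost)
    have "measure coins (D i) \<le> 2 * exp (- \<kappa>\<^sup>2 / (2 * \<kappa> * 1))"
      unfolding D_def eq using \<kappa> by (intro walk_tail_le K feature_norm_le) auto
    thus ?thesis using \<kappa> by (simp add: power2_eq_square)
  qed
  have Z: "measure coins (Z i k m) \<le> 2 * exp (- l\<^sup>2 / (2 * \<kappa> * real H))"
    if "i \<in> {1..t}" "k \<in> {1..d}" "m \<in> {..<2^H}" for i k m
  proof -
    \<comment> \<open>The normalization of the features costs the factor \<open>sqrt (d * H)\<close>
      in the prefix sums.\<close>
    have "(\<Sum>j=1..i. walk ?K \<kappa> \<omega> j * dotp ?B (?v j) (prefix_vec k m))
        = (\<Sum>j=1..i. walk ?K \<kappa> \<omega> j * (if q j k < m then 1 else 0)) / sqrt (real d * real H)" for \<omega>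
      unfolding sum_divide_distrib
      by (intro sum.cong) (use that q in \<open>auto simp: dotp_feature_prefix\<close>)
    moreover have "sqrt (real d * real H) > 0" using d H by simp
    ultimately have "Z i k m = {\<omega> \<in> space coins.
        \<bar>\<Sum>j=1..i. walk ?K \<kappa> \<omega> j * dotp ?B (?v j) (prefix_vec k m)\<bar> > l}"
      unfolding Z_def by (auto simp: abs_divide pos_less_divide_eq mult.commute)
    also have "measure coins \<dots> \<le> 2 * exp (- l\<^sup>2 / (2 * \<kappa> * real H))"
      using \<kappa> l H by (intro walk_tail_le K feature_norm_le prefix_vec_norm_le) auto
    finally show ?thesis .
  qed
  have "measure coins (\<Union>i\<in>{1..t}. D i) \<le> (\<Sum>i=1..t. measure coins (D i))"
    by (rule finite_measure_subadditive_finite) auto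
  also have "\<dots> \<le> (\<Sum>i=1..t. 2 * exp (- \<kappa> / 2))"
    by (intro sum_mono D)
  finally have 1: "measure coins (\<Union>i\<in>{1..t}. D i) \<le> real t * (2 * exp (- \<kappa> / 2))"
    by simp
  have "measure coins (\<Union>(i, k, m)\<in>{1..t} \<times> {1..d} \<times> {..<2^H}. Z i k m)
      \<le> (\<Sum>(i, k, m)\<in>{1..t} \<times> {1..d} \<times> {..<(2::nat)^H}. measure coins (Z i k m))"
    unfolding case_prod_beta by (rule finite_measure_subadditive_finite) auto
  also have "\<dots> \<le> (\<Sum>(i, k, m)\<in>{1..t} \<times> {1..d} \<times> {..<(2::nat)^H}. 2 * exp (- l\<^sup>2 / (2 * \<kappa> * real H)))"
    by (intro sum_mono) (use Z in auto)
  finally have 2: "measure coins (\<Union>(i, k, m)\<in>{1..t} \<times> {1..d} \<times> {..<2^H}. Z i k m)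
      \<le> real t * (real d * (2^H * (2 * exp (- l\<^sup>2 / (2 * \<kappa> * real H)))))"
    by (simp add: card_cartesian_product case_prod_beta algebra_simps)
  have "measure coins {\<omega> \<in> space coins. \<not> (\<forall>i\<in>{1..t}. \<bar>drift ?K \<kappa> \<omega> i\<bar> \<le> \<kappa> \<and>
      (\<forall>k\<in>{1..d}. \<forall>m\<in>{..<2^H}.
         \<bar>\<Sum>j=1..i. walk ?K \<kappa> \<omega> j * (if q j k < m then 1 else 0)\<bar>
           \<le> sqrt (real d * real H) * l))}
    \<le> measure coins ((\<Union>i\<in>{1..t}. D i) \<union> (\<Union>(i, k, m)\<in>{1..t} \<times> {1..d} \<times> {..<2^H}. Z i k m))"
  proof (intro finite_measure_mono subsetI)
    fix \<omega> assume "\<omega> \<in> {\<omega> \<in> space coins. \<not> (\<forall>i\<in>{1..t}. \<bar>drift ?K \<kappa> \<omega> i\<bar> \<le> \<kappa> \<and>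
      (\<forall>k\<in>{1..d}. \<forall>m\<in>{..<2^H}.
         \<bar>\<Sum>j=1..i. walk ?K \<kappa> \<omega> j * (if q j k < m then 1 else 0)\<bar>
           \<le> sqrt (real d * real H) * l))}"
    hence sp: "\<omega> \<in> space coins" and "\<not> (\<forall>i\<in>{1..t}. \<bar>drift ?K \<kappa> \<omega> i\<bar> \<le> \<kappa> \<and>
      (\<forall>k\<in>{1..d}. \<forall>m\<in>{..<2^H}.
         \<bar>\<Sum>j=1..i. walk ?K \<kappa> \<omega> j * (if q j k < m then 1 else 0)\<bar>
           \<le> sqrt (real d * real H) * l))"
      unfolding mem_Collect_eq by blast+
    then obtain i where i: "i \<in> {1..t}" and "\<not> \<bar>drift ?K \<kappa> \<omega> i\<bar> \<le> \<kappa> \<or>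
      \<not> (\<forall>k\<in>{1..d}. \<forall>m\<in>{..<2^H}.
         \<bar>\<Sum>j=1..i. walk ?K \<kappa> \<omega> j * (if q j k < m then 1 else 0)\<bar>
           \<le> sqrt (real d * real H) * l)"
      by blast
    hence "\<omega> \<in> D i \<or> (\<exists>k\<in>{1..d}. \<exists>m\<in>{..<2^H}. \<omega> \<in> Z i k m)"
      unfolding D_def Z_def mem_Collect_eq not_le[symmetric] using sp by blast
    with i show "\<omega> \<in> (\<Union>i\<in>{1..t}. D i) \<union> (\<Union>(i, k, m)\<in>{1..t} \<times> {1..d} \<times> {..<2^H}. Z i k m)"
      by blast
  qed (intro sets.Un sets.finite_UN; auto)
  also have "\<dots> \<le> measure coins (\<Union>i\<in>{1..t}. D i)
      + measure coins (\<Union>(i, k, m)\<in>{1..t} \<times> {1..d} \<times> {..<2^H}. Z i k m)"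
    by (intro measure_Un_le sets.finite_UN) auto
  finally show ?thesis using 1 2 by linarith
qed

subsection \<open>Cells\<close>

text \<open>
  Monotone, and equal at \<open>a < b\<close> only if \<open>{a..b}\<close> has measure at most \<open>1 / M\<close>; using both one-sided
  limits of the distribution function puts every heavy atom into a cell of its own.
\<close>

definition cell :: "nat \<Rightarrow> real measure \<Rightarrow> real \<Rightarrow> nat" where
  "cell M \<mu> y = nat \<lfloor>real M * measure \<mu> {..<y}\<rfloor> + nat \<lfloor>real M * measure \<mu> {..y}\<rfloor>"

context
  fixes \<mu> :: "real measure" and M :: nat
  assumes prob: "prob_space \<mu>" and sets [measurable_cong, simp]: "sets \<mu> = sets borel"
begin

interpretation prob_space \<mu> by (rule prob)

lemma cell_mono: "x \<le> y \<Longrightarrow> cell M \<mu> x \<le> cell M \<mu> y"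
proof -
  assume "x \<le> y"
  hence "measure \<mu> {..<x} \<le> measure \<mu> {..<y}" "measure \<mu> {..x} \<le> measure \<mu> {..y}"
    by (intro finite_measure_mono; auto)+
  thus ?thesis
    unfolding cell_def by (intro add_mono nat_mono floor_mono mult_left_mono) simp_all
qed

lemma cell_le: "cell M \<mu> x \<le> 2 * M"
proof -
  have *: "nat \<lfloor>real M * measure \<mu> A\<rfloor> \<le> M" for A
  proof -
    have "real M * measure \<mu> A \<le> real M * 1" by (intro mult_left_mono) auto
    thus ?thesis by linarith
  qed
  show ?thesis
    unfolding cell_def mult_2 by (intro add_mono *)
qed

lemma cell_measurable [measurable]: "cell M \<mu> \<in> borel \<rightarrow>\<^sub>M count_space UNIV"
proof -
  have [measurable]: "(\<lambda>y. measure \<mu> {..<y}) \<in> borel_measurable borel"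
    "(\<lambda>y. measure \<mu> {..y}) \<in> borel_measurable borel"
    by (intro borel_measurable_mono monoI finite_measure_mono; auto)+
  show ?thesis unfolding cell_def[abs_def] by measurable
qed

text \<open>\<open>M * measure \<mu> {a..b}\<close> is the scaled distribution function at
  \<open>b\<close> minus its scaled left limit at \<open>a\<close>, and these two numbers have the
  same integer part.\<close>

lemma measure_same_cell_interval_le:
  assumes "a < b" "cell M \<mu> a = cell M \<mu> b"
  shows "real M * measure \<mu> {a..b} \<le> 1"
proof -
  let ?l = "\<lambda>y. real M * measure \<mu> {..<y}" and ?r = "\<lambda>y. real M * measure \<mu> {..y}"
  have "?l a \<le> ?r a" "?r a \<le> ?l b" "?l b \<le> ?r b"
    using assms(1) by (intro mult_left_mono finite_measure_mono; auto)+
  hence "nat \<lfloor>?l a\<rfloor> \<le> nat \<lfloor>?r a\<rfloor>" "nat \<lfloor>?r a\<rfloor> \<le> nat \<lfloor>?l b\<rfloor>" "nat \<lfloor>?l b\<rfloor> \<le> nat \<lfloor>?r b\<rfloor>"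
    by (simp_all only: nat_mono floor_mono)
  \<comment> \<open>Four floors form an increasing chain in which the first two have the same sum as
    the last two, so all four are equal.\<close>
  with assms(2) have "nat \<lfloor>?l a\<rfloor> = nat \<lfloor>?r b\<rfloor>" by (simp add: cell_def)
  moreover have "?l a \<ge> 0" "?r b \<ge> 0" by auto
  ultimately have "?r b - ?l a \<le> 1" by linarith
  moreover have "measure \<mu> {a..b} = measure \<mu> {..b} - measure \<mu> {..<a}"
  proof -
    have "{a..b} = {..b} - {..<a}" by auto
    moreover have "measure \<mu> ({..b} - {..<a}) = measure \<mu> {..b} - measure \<mu> {..<a}"
      using assms(1) by (intro finite_measure_Diff) auto
    ultimately show ?thesis by simp
  qed
  ultimately show ?thesis by (simp add: right_diff_distrib)
qed

text \<open>Deleting \<open>x\<close> leaves nothing if the cell of \<open>x\<close> is a single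
  point, possibly a heavy atom. Any other cell is light as a whole: it need not attain its ends, so
  it is exhausted by compact subsets, each lying between two points of the cell.\<close>

lemma measure_same_cell_le:
  assumes "M > 0"
  shows "measure \<mu> {y. cell M \<mu> y = cell M \<mu> x \<and> y \<noteq> x} \<le> 1 / real M"
proof (cases "\<exists>y. cell M \<mu> y = cell M \<mu> x \<and> y \<noteq> x")
  case True
  let ?S = "{y. cell M \<mu> y = cell M \<mu> x}"
  have S: "?S \<in> sets borel" by measurable
  have dist: "measure \<mu> {a..b} \<le> 1 / real M" if ab: "a \<in> ?S" "b \<in> ?S" for a b
  proof -
    have lt: "measure \<mu> {a..b} \<le> 1 / real M" if "a < b" "a \<in> ?S" "b \<in> ?S" for a b
      using measure_same_cell_interval_le[of a b] that assms by (simp add: field_simps)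
    consider "a < b" | "b < a" | "a = b" by linarith
    thus ?thesis
    proof cases
      \<comment> \<open>A degenerate segment is enclosed in one that has a second point of the cell
        as its other end.\<close>
      case 3
      obtain y where "y \<in> ?S" "y \<noteq> a" using True ab by (metis (mono_tags) mem_Collect_eq)
      hence "measure \<mu> {min a y..max a y} \<le> 1 / real M"
        by (intro lt) (use ab in \<open>auto simp: min_def max_def\<close>)
      moreover have "measure \<mu> {a..b} \<le> measure \<mu> {min a y..max a y}"
        using 3 by (intro finite_measure_mono) auto
      ultimately show ?thesis by linarith
    qed (use lt ab in auto)
  qed
  have "emeasure \<mu> ?S = (SUP K\<in>{K. K \<subseteq> ?S \<and> compact K}. emeasure \<mu> K)"
    using S by (intro inner_regular) auto
  also have "\<dots> \<le> ennreal (1 / real M)"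
  proof (rule SUP_least)
    fix K assume "K \<in> {K. K \<subseteq> ?S \<and> compact K}"
    hence K: "K \<subseteq> ?S" "compact K" by auto
    show "emeasure \<mu> K \<le> ennreal (1 / real M)"
    proof (cases "K = {}")
      case False
      obtain a where a: "a \<in> K" "\<forall>y\<in>K. a \<le> y" using compact_attains_inf[OF K(2) False] by blast
      obtain b where b: "b \<in> K" "\<forall>y\<in>K. y \<le> b" using compact_attains_sup[OF K(2) False] by blast
      have "measure \<mu> K \<le> measure \<mu> {a..b}"
        using a b by (intro finite_measure_mono) auto
      also have "\<dots> \<le> 1 / real M"
        using a b K by (intro dist) auto
      finally show ?thesis by (simp add: emeasure_eq_measure ennreal_leI)
    qed simp
  qed
  finally have "measure \<mu> ?S \<le> 1 / real M"
    by (simp add: emeasure_eq_measure)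
  moreover have "measure \<mu> {y. cell M \<mu> y = cell M \<mu> x \<and> y \<noteq> x} \<le> measure \<mu> ?S"
    using S by (intro finite_measure_mono) auto
  ultimately show ?thesis by linarith
next
  case False
  hence "{y. cell M \<mu> y = cell M \<mu> x \<and> y \<noteq> x} = {}" by blast
  thus ?thesis by (simp only: measure_empty) simp
qed

end

section \<open>Coordinate marginals and collisions of sample points\<close>

definition marginal :: "(nat \<Rightarrow> real) measure \<Rightarrow> nat \<Rightarrow> real measure" where
  "marginal p k = distr p borel (\<lambda>z. z k)"

lemma cube_coordinate_measurable:
  assumes "cube_distribution d p" "k \<in> {1..d}"
  shows "(\<lambda>z. z k) \<in> borel_measurable p"
proof -
  have "(\<lambda>z. z k) \<in> unit_cube d \<rightarrow>\<^sub>M restrict_space borel {0..1}"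
    unfolding unit_cube_def using assms(2) by (rule measurable_component_singleton)
  hence "(\<lambda>z. z k) \<in> borel_measurable (unit_cube d)"
    by (simp add: measurable_restrict_space2_iff)
  thus ?thesis
    using assms(1) by (simp add: cube_distribution_def cong: measurable_cong_sets)
qed

lemma cube_coordinate_bounds:
  assumes "cube_distribution d p" "k \<in> {1..d}" "z \<in> space p"
  shows "z k \<in> {0..1}"
proof -
  have "space p = space (unit_cube d)"
    using assms(1) by (intro sets_eq_imp_space_eq) (simp add: cube_distribution_def)
  thus ?thesis
    using assms(2,3) by (auto simp: unit_cube_def space_PiM space_restrict_space PiE_def Pi_def)
qed

lemma prob_space_marginal:
  assumes "cube_distribution d p" "k \<in> {1..d}"
  shows "prob_space (marginal p k)"
proof -
  have "prob_space p" using assms(1) by (simp add: cube_distribution_def)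
  thus ?thesis
    unfolding marginal_def by (rule prob_space.prob_space_distr[OF _ cube_coordinate_measurable[OF assms]])
qed

lemma sets_marginal [simp]: "sets (marginal p k) = sets borel"
  by (simp add: marginal_def)

definition code :: "nat \<Rightarrow> (nat \<Rightarrow> real) measure \<Rightarrow> (nat \<Rightarrow> nat \<Rightarrow> real) \<Rightarrow> nat \<Rightarrow> nat \<Rightarrow> nat" where
  "code M p x j k = cell M (marginal p k) (x j k)"

lemma sample_coordinate_measurable:
  assumes "cube_distribution d p" "k \<in> {1..d}" "j \<in> J"
  shows "(\<lambda>x. x j k) \<in> borel_measurable (PiM J (\<lambda>_. p))"
proof -
  have "(\<lambda>x. x j) \<in> PiM J (\<lambda>_. p) \<rightarrow>\<^sub>M p"
    using assms(3) by (rule measurable_component_singleton)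
  from measurable_compose[OF this cube_coordinate_measurable[OF assms(1,2)]] show ?thesis .
qed

lemma code_measurable:
  assumes "cube_distribution d p" "k \<in> {1..d}" "j \<in> J"
  shows "(\<lambda>x. code M p x j k) \<in> PiM J (\<lambda>_. p) \<rightarrow>\<^sub>M count_space UNIV"
  using measurable_compose[OF sample_coordinate_measurable[OF assms]
      cell_measurable[OF prob_space_marginal[OF assms(1,2)] sets_marginal]]
  unfolding code_def .

lemma collision_sets:
  assumes p: "cube_distribution d p" and k: "k \<in> {1..d}" and ij: "i \<in> J" "j \<in> J"
  shows "{x \<in> space (PiM J (\<lambda>_. p)). code M p x j k = code M p x i k \<and> x j k \<noteq> x i k}
      \<in> sets (PiM J (\<lambda>_. p))" (is "?S \<in> sets ?P")
proof -
  note [measurable] = code_measurable[OF p k ij(1), of M] code_measurable[OF p k ij(2), of M]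
    sample_coordinate_measurable[OF p k ij(1)] sample_coordinate_measurable[OF p k ij(2)]
  have "{x \<in> space ?P. code M p x j k = code M p x i k} \<in> sets ?P"
    by measurable
  moreover have "{x \<in> space ?P. x j k \<noteq> x i k} \<in> sets ?P"
    by (intro borel_measurable_neq) measurable
  moreover have "?S = {x \<in> space ?P. code M p x j k = code M p x i k} \<inter> {x \<in> space ?P. x j k \<noteq> x i k}"
    by auto
  ultimately show ?thesis by (simp only: sets.Int)
qed

text \<open>For \<open>i \<noteq> j\<close> the points are independent. With all points but the
  \<open>j\<close>-th fixed, a collision means that a variable of law \<open>marginal p k\<close>
  hits the cell of \<open>x i k\<close> outside \<open>x i k\<close> itself. For
  \<open>i = j\<close> the event is empty.\<close>

lemma pair_collision_le:
  assumes p: "cube_distribution d p" and k: "k \<in> {1..d}" and "M > 0"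
    and ij: "i \<in> {1..t}" "j \<in> {1..t}"
  shows "measure (PiM {1..t} (\<lambda>_. p))
      {x \<in> space (PiM {1..t} (\<lambda>_. p)). code M p x j k = code M p x i k \<and> x j k \<noteq> x i k} \<le> 1 / real M"
proof (cases "i = j")
  case False
  interpret p: prob_space p using p by (simp add: cube_distribution_def)
  interpret product_prob_space "\<lambda>_::nat. p" "{1..t}" by unfold_locales
  let ?P = "PiM {1..t} (\<lambda>_. p)"
  define J where "J = {1..t} - {j}"
  have J: "{1..t} = insert j J" "finite J" "j \<notin> J" "i \<in> J"
    using ij False by (auto simp: J_def)
  interpret PJ: prob_space "PiM J (\<lambda>_. p)" by (intro prob_space_PiM p.prob_space_axioms)
  note [measurable] = cube_coordinate_measurable[OF p k]
  let ?S = "{x \<in> space ?P. code M p x j k = code M p x i k \<and> x j k \<noteq> x i k}"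
  have S [measurable]: "?S \<in> sets ?P"
    by (rule collision_sets[OF p k ij])
  have "emeasure ?P ?S = (\<integral>\<^sup>+x. indicator ?S x \<partial>?P)"
    using S by simp
  also have "\<dots> = (\<integral>\<^sup>+x. \<integral>\<^sup>+y. indicator ?S (x(j := y)) \<partial>p \<partial>PiM J (\<lambda>_. p))"
    using S unfolding J(1) by (intro product_nn_integral_insert J) auto
  also have "\<dots> \<le> (\<integral>\<^sup>+x. ennreal (1 / real M) \<partial>PiM J (\<lambda>_. p))"
  proof (rule nn_integral_mono)
    fix x assume "x \<in> space (PiM J (\<lambda>_. p))"
    let ?c = "cell M (marginal p k)"
    have pr: "prob_space (marginal p k)" using prob_space_marginal[OF p k] .
    note [measurable] = cell_measurable[OF pr sets_marginal]
    define T where "T = {y. ?c y = ?c (x i k) \<and> y \<noteq> x i k}"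
    have T [measurable]: "T \<in> sets borel" unfolding T_def by measurable
    have "(\<integral>\<^sup>+y. indicator ?S (x(j := y)) \<partial>p) \<le> (\<integral>\<^sup>+y. indicator T (y k) \<partial>p)"
      using J by (intro nn_integral_mono) (auto simp: indicator_def code_def T_def)
    also have "\<dots> = (\<integral>\<^sup>+y. indicator T y \<partial>marginal p k)"
      unfolding marginal_def
      by (rule nn_integral_distr[OF cube_coordinate_measurable[OF p k], symmetric]) simp
    also have "\<dots> = emeasure (marginal p k) T"
      by (rule nn_integral_indicator) simp
    also have "\<dots> \<le> ennreal (1 / real M)"
      unfolding T_def finite_measure.emeasure_eq_measure[OF prob_space.finite_measure[OF pr]]
      by (intro ennreal_leI measure_same_cell_le pr sets_marginal \<open>M > 0\<close>)
    finally show "(\<integral>\<^sup>+y. indicator ?S (x(j := y)) \<partial>p) \<le> ennreal (1 / real M)" .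
  qed
  also have "\<dots> = ennreal (1 / real M)"
    by (simp add: PJ.emeasure_space_1)
  finally show ?thesis
    unfolding P.emeasure_eq_measure by simp
qed simp

lemma collision_le:
  assumes p: "cube_distribution d p" and "M > 0"
  shows "measure (PiM {1..t} (\<lambda>_. p)) {x \<in> space (PiM {1..t} (\<lambda>_. p)).
      \<exists>i\<in>{1..t}. \<exists>j\<in>{1..t}. \<exists>k\<in>{1..d}. code M p x j k = code M p x i k \<and> x j k \<noteq> x i k}
    \<le> real t * (real t * real d) / real M"
proof -
  interpret p: prob_space p using p by (simp add: cube_distribution_def)
  let ?P = "PiM {1..t} (\<lambda>_. p)"
  interpret P: prob_space ?P by (intro prob_space_PiM p.prob_space_axioms)
  define S where "S i j k = {x \<in> space ?P. code M p x j k = code M p x i k \<and> x j k \<noteq> x i k}" for i j k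
  have S: "S i j k \<in> sets ?P" if "i \<in> {1..t}" "j \<in> {1..t}" "k \<in> {1..d}" for i j k
    unfolding S_def by (rule collision_sets[OF p that(3,1,2)])
  have "measure ?P (\<Union>(i, j, k)\<in>{1..t} \<times> {1..t} \<times> {1..d}. S i j k)
      \<le> (\<Sum>(i, j, k)\<in>{1..t} \<times> {1..t} \<times> {1..d}. measure ?P (S i j k))"
    unfolding case_prod_beta by (rule P.finite_measure_subadditive_finite) (use S in auto)
  also have "\<dots> \<le> (\<Sum>(i, j, k)\<in>{1..t} \<times> {1..t} \<times> {1..d}. 1 / real M)"
    using pair_collision_le[OF p _ \<open>M > 0\<close>] by (intro sum_mono) (auto simp: S_def)
  also have "\<dots> = real t * (real t * real d) / real M"
    by (simp add: card_cartesian_product case_prod_beta)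
  also have "(\<Union>(i, j, k)\<in>{1..t} \<times> {1..t} \<times> {1..d}. S i j k) = {x \<in> space ?P.
      \<exists>i\<in>{1..t}. \<exists>j\<in>{1..t}. \<exists>k\<in>{1..d}. code M p x j k = code M p x i k \<and> x j k \<noteq> x i k}"
    unfolding S_def by blast
  finally show ?thesis .
qed

subsection \<open>The online strategy\<close>

text \<open>By convexity, the smallest and the largest member inside \<open>I\<close> determine its
  trace on a finite family. Uncountably many intervals thus reduce to finitely many pairs of sample
  indices.\<close>

lemma interval_trace:
  fixes I :: "real set" and y :: "nat \<Rightarrow> real"
  assumes "is_interval I" "finite J"
  obtains "\<And>j. j \<in> J \<Longrightarrow> y j \<notin> I"
  | l m where "l \<in> J" "m \<in> J" "\<And>j. j \<in> J \<Longrightarrow> y j \<in> I \<longleftrightarrow> y l \<le> y j \<and> y j \<le> y m"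
proof (cases "\<exists>j\<in>J. y j \<in> I")
  case True
  define A where "A = {j \<in> J. y j \<in> I}"
  have A: "finite A" "A \<noteq> {}" using assms True by (auto simp: A_def)
  obtain l where l: "l \<in> A" "\<And>j. j \<in> A \<Longrightarrow> y l \<le> y j"
    using arg_min_if_finite[OF A, of y] by (metis linorder_not_less)
  obtain m where m: "m \<in> A" "\<And>j. j \<in> A \<Longrightarrow> y j \<le> y m"
    using arg_min_if_finite[OF A, of "\<lambda>j. - y j"] by (metis linorder_not_less neg_less_iff_less)
  show ?thesis
  proof (rule that(2))
    show "l \<in> J" "m \<in> J" using l m by (auto simp: A_def)
    fix j assume "j \<in> J"
    show "y j \<in> I \<longleftrightarrow> y l \<le> y j \<and> y j \<le> y m"
    proof
      assume "y j \<in> I"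
      thus "y l \<le> y j \<and> y j \<le> y m" using \<open>j \<in> J\<close> l m by (auto simp: A_def)
    next
      assume "y l \<le> y j \<and> y j \<le> y m"
      thus "y j \<in> I"
        using l(1) m(1) mem_is_interval_1_I[OF assms(1), of "y l" "y m" "y j"] by (auto simp: A_def)
    qed
  qed
qed (use that(1) in blast)

text \<open>The finite form makes the success event measurable. Points in the unit interval make the
  segments between them admissible, and \<open>b \<ge> 0\<close> covers intervals that miss all
  points.\<close>

lemma disc_intervals_iff:
  fixes \<epsilon> :: "nat \<Rightarrow> real"
  assumes x: "\<And>j. j \<in> {1..i} \<Longrightarrow> x j k \<in> {0..1}" and "b \<ge> 0"
  shows "(\<forall>I. is_interval I \<and> I \<subseteq> {0..1} \<longrightarrow> disc \<epsilon> x I i k \<le> b) \<longleftrightarrow>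
    (\<forall>l\<in>{1..i}. \<forall>m\<in>{1..i}.
      \<bar>\<Sum>j=1..i. \<epsilon> j * (if x l k \<le> x j k \<and> x j k \<le> x m k then 1 else 0)\<bar> \<le> b)" (is "?L \<longleftrightarrow> ?R")
proof
  assume L: ?L
  show ?R
  proof (intro ballI)
    fix l m assume lm: "l \<in> {1..i}" "m \<in> {1..i}"
    have "{x l k..x m k} \<subseteq> {0..1}" using x[OF lm(1)] x[OF lm(2)] by auto
    hence "disc \<epsilon> x {x l k..x m k} i k \<le> b"
      using L is_interval_cc by blast
    thus "\<bar>\<Sum>j=1..i. \<epsilon> j * (if x l k \<le> x j k \<and> x j k \<le> x m k then 1 else 0)\<bar> \<le> b"
      by (simp only: disc_def indicator_def of_bool_def atLeastAtMost_iff)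
  qed
next
  assume R: ?R
  show ?L
  proof (intro allI impI, elim conjE)
    fix I :: "real set" assume I: "is_interval I"
    show "disc \<epsilon> x I i k \<le> b"
    proof (rule interval_trace[OF I, of "{1..i}" "\<lambda>j. x j k"])
      assume "\<And>j. j \<in> {1..i} \<Longrightarrow> x j k \<notin> I"
      hence "disc \<epsilon> x I i k = 0" by (simp add: disc_def)
      thus ?thesis using \<open>b \<ge> 0\<close> by simp
    next
      fix l m assume lm: "l \<in> {1..i}" "m \<in> {1..i}"
        and I: "\<And>j. j \<in> {1..i} \<Longrightarrow> x j k \<in> I \<longleftrightarrow> x l k \<le> x j k \<and> x j k \<le> x m k"
      have "(\<Sum>j=1..i. \<epsilon> j * indicator I (x j k))
          = (\<Sum>j=1..i. \<epsilon> j * (if x l k \<le> x j k \<and> x j k \<le> x m k then 1 else 0))"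
        by (intro sum.cong) (use I in \<open>auto simp: indicator_def\<close>)
      thus ?thesis using R lm by (simp add: disc_def)
    qed auto
  qed
qed

lemma chosen_sign_measurable:
  assumes A: "online_strategy p t A" and i: "i \<in> {1..t}"
  shows "(\<lambda>z. chosen_sign A (fst z) (snd z) i) \<in> borel_measurable (run_space p t)"
proof -
  have sub: "(\<lambda>x. restrict x {1..i}) \<in> PiM {1..t} (\<lambda>_. p) \<rightarrow>\<^sub>M PiM {1..i} (\<lambda>_. p)"
    by (rule measurable_restrict_subset) (use i in auto)
  have "(\<lambda>z. restrict (fst z) {1..i}) \<in> run_space p t \<rightarrow>\<^sub>M PiM {1..i} (\<lambda>_. p)"
    unfolding run_space_def by (rule measurable_compose[OF measurable_fst sub])
  hence "(\<lambda>z. (restrict (fst z) {1..i}, snd z)) \<in> run_space p t \<rightarrow>\<^sub>M run_space p i"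
    unfolding run_space_def by (intro measurable_Pair measurable_snd)
  moreover have "A i \<in> run_space p i \<rightarrow>\<^sub>M count_space {-1, 1}"
    using A i by (auto simp: online_strategy_def)
  ultimately have "(\<lambda>z. A i (restrict (fst z) {1..i}, snd z)) \<in> run_space p t \<rightarrow>\<^sub>M count_space {-1, 1}"
    by (rule measurable_compose)
  from measurable_compose[OF this, of "\<lambda>y. y" borel] show ?thesis
    by (simp add: chosen_sign_def)
qed

lemma code_measurable_run:
  assumes "cube_distribution d p" "k \<in> {1..d}" "j \<in> {1..n}"
  shows "(\<lambda>z. code M p (fst z) j k) \<in> run_space p n \<rightarrow>\<^sub>M count_space UNIV"
  unfolding run_space_def by (rule measurable_compose[OF measurable_fst code_measurable[OF assms]])

lemma coordinate_measurable_run: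
  assumes "cube_distribution d p" "k \<in> {1..d}" "j \<in> {1..n}"
  shows "(\<lambda>z. fst z j k) \<in> borel_measurable (run_space p n)"
  unfolding run_space_def
  by (rule measurable_compose[OF measurable_fst sample_coordinate_measurable[OF assms]])

lemma coin_measurable_run: "(\<lambda>z. snd z j) \<in> borel_measurable (run_space p n)"
  unfolding run_space_def
  by (rule measurable_compose[OF measurable_snd coins_component_measurable])

lemma feature_kernel_measurable_run:
  assumes p: "cube_distribution d p" and ji: "j \<in> {1..n}" "i \<in> {1..n}"
  shows "(\<lambda>z. feature_kernel d H (code M p (fst z)) j i) \<in> borel_measurable (run_space p n)"
proof -
  have feat: "(\<lambda>z. feature d H (code M p (fst z) j) b) \<in> borel_measurable (run_space p n)"
    if "b \<in> nodes d H" "j \<in> {1..n}" for b j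
  proof -
    obtain k h a where b: "b = (k, h, a)" by (cases b)
    have "k \<in> {1..d}" using that(1) by (simp add: b nodes_def)
    from measurable_compose[OF code_measurable_run[OF p this that(2), of M], of
      "\<lambda>c. if a = c div 2^h then 1 / sqrt (real d * real H) else 0" borel]
    show ?thesis by (simp add: b feature_def)
  qed
  show ?thesis
    unfolding feature_kernel_def dotp_def
    by (intro borel_measurable_sum borel_measurable_times feat ji)
qed

text \<open>Unlike \<open>walk\<close>, this is always a sign, since large drifts get no special
  branch. The drift is that of \<open>walk\<close>, recomputed from cells and coins rather than from
  the signs put out; output and \<open>walk\<close> agree whenever the current drift is within
  \<open>\<kappa>\<close>.\<close>

definition balancing_sign :: "nat \<Rightarrow> nat \<Rightarrow> nat \<Rightarrow> real \<Rightarrow> (nat \<Rightarrow> real) measure \<Rightarrow> strategy" where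
  "balancing_sign d H M \<kappa> p i z =
     (if snd z i \<le> 1/2 - drift (feature_kernel d H (code M p (fst z))) \<kappa> (snd z) i / (2 * \<kappa>)
      then 1 else -1)"

lemma online_balancing_sign:
  assumes p: "cube_distribution d p"
  shows "online_strategy p t (balancing_sign d H M \<kappa> p)"
  unfolding online_strategy_def
proof
  fix i assume i: "i \<in> {1..t}"
  have [measurable]: "(\<lambda>z. drift (feature_kernel d H (code M p (fst z))) \<kappa> (snd z) i)
      \<in> borel_measurable (run_space p i)"
    by (rule drift_measurable[of i]) (auto intro!: feature_kernel_measurable_run[OF p] coin_measurable_run)
  note [measurable] = coin_measurable_run
  have "{z \<in> space (run_space p i).
      snd z i \<le> 1/2 - drift (feature_kernel d H (code M p (fst z))) \<kappa> (snd z) i / (2 * \<kappa>)}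
      \<in> sets (run_space p i)"
    by measurable
  thus "balancing_sign d H M \<kappa> p i \<in> run_space p i \<rightarrow>\<^sub>M count_space {-1, 1}"
    unfolding balancing_sign_def[abs_def]
    by (intro measurable_If) auto
qed

text \<open>The drift at time \<open>i\<close> reads only points up to \<open>i\<close>, so
  restricting the history does not change it; within the bound, the rule is the random branch of
  \<open>walk_step\<close>.\<close>

lemma chosen_balancing_sign:
  assumes "1 \<le> i" and "\<bar>drift (feature_kernel d H (code M p x)) \<kappa> \<omega> i\<bar> \<le> \<kappa>"
  shows "chosen_sign (balancing_sign d H M \<kappa> p) x \<omega> i = walk (feature_kernel d H (code M p x)) \<kappa> \<omega> i"
proof -
  have "drift (feature_kernel d H (code M p (restrict x {1..i}))) \<kappa> \<omega> i
      = drift (feature_kernel d H (code M p x)) \<kappa> \<omega> i"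
  proof (rule drift_cong)
    fix j l assume "1 \<le> j" "j < l" "l \<le> i"
    hence "code M p (restrict x {1..i}) j = code M p x j" "code M p (restrict x {1..i}) l = code M p x l"
      by (auto simp: code_def fun_eq_iff)
    thus "feature_kernel d H (code M p (restrict x {1..i})) j l = feature_kernel d H (code M p x) j l"
      by (simp add: feature_kernel_def)
  qed simp
  thus ?thesis
    using assms(2) by (simp add: chosen_sign_def balancing_sign_def walk_eq_step walk_step_def)
qed

text \<open>Without collisions the cell numbers order the sample as the coordinate does. The trace
  of \<open>I\<close> is then a range of cells, the difference of two prefixes that contribute
  \<open>S\<close> each.\<close>

lemma disc_le_of_prefix_bounds:
  assumes p: "cube_distribution d p" and k: "k \<in> {1..d}" and i: "i \<in> {1..t}"
    and I: "is_interval I" and M: "Suc (2 * M) < N" and S: "S \<ge> 0"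
    and sep: "\<And>l j. l \<in> {1..t} \<Longrightarrow> j \<in> {1..t} \<Longrightarrow> code M p x j k = code M p x l k \<Longrightarrow> x j k = x l k"
    and prefix: "\<And>m. m < N \<Longrightarrow> \<bar>\<Sum>j=1..i. \<epsilon> j * (if code M p x j k < m then 1 else 0)\<bar> \<le> S"
  shows "disc \<epsilon> x I i k \<le> 2 * S"
proof (rule interval_trace[OF I, of "{1..i}" "\<lambda>j. x j k"])
  assume "\<And>j. j \<in> {1..i} \<Longrightarrow> x j k \<notin> I"
  hence "disc \<epsilon> x I i k = 0" by (simp add: disc_def)
  thus ?thesis using S by simp
next
  let ?c = "\<lambda>j. code M p x j k"
  note mono = cell_mono[OF prob_space_marginal[OF p k] sets_marginal, of _ _ M]
  note le = cell_le[OF prob_space_marginal[OF p k] sets_marginal, of M]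
  fix l m assume lm: "l \<in> {1..i}" "m \<in> {1..i}"
    and I: "\<And>j. j \<in> {1..i} \<Longrightarrow> x j k \<in> I \<longleftrightarrow> x l k \<le> x j k \<and> x j k \<le> x m k"
  have iff: "x u k \<le> x v k \<longleftrightarrow> ?c u \<le> ?c v" if "u \<in> {1..i}" "v \<in> {1..i}" for u v
  proof
    assume "?c u \<le> ?c v"
    show "x u k \<le> x v k"
    proof (rule ccontr)
      assume "\<not> x u k \<le> x v k"
      hence "?c v \<le> ?c u" using mono[of "x v k" "x u k"] by (simp add: code_def)
      with \<open>?c u \<le> ?c v\<close> have "x u k = x v k" using sep[of v u] that i by simp
      with \<open>\<not> x u k \<le> x v k\<close> show False by simp
    qed
  qed (use mono in \<open>simp add: code_def\<close>)
  show ?thesis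
  proof (cases "?c l \<le> ?c m")
    case True
    have "indicator I (x j k) = (if ?c j < Suc (?c m) then 1 else 0) - (if ?c j < ?c l then 1 else 0 :: real)"
      if "j \<in> {1..i}" for j
      using I[OF that] iff[OF lm(1) that] iff[OF that lm(2)] True by (auto simp: indicator_def)
    hence "(\<Sum>j=1..i. \<epsilon> j * indicator I (x j k)) = (\<Sum>j=1..i. \<epsilon> j * (if ?c j < Suc (?c m) then 1 else 0))
        - (\<Sum>j=1..i. \<epsilon> j * (if ?c j < ?c l then 1 else 0))"
      unfolding sum_subtractf[symmetric] by (intro sum.cong) (simp_all add: right_diff_distrib)
    \<comment> \<open>Cell numbers reach \<open>2 * M\<close>, and including the right end shifts
      the prefix by one, hence the hypothesis \<open>Suc (2 * M) < N\<close>.\<close>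
    moreover have "Suc (?c m) < N" "?c l < N"
      using M le[of "x m k"] le[of "x l k"] by (auto simp: code_def)
    ultimately show ?thesis
      using prefix[of "Suc (?c m)"] prefix[of "?c l"] unfolding disc_def by linarith
  next
    case False
    hence "x j k \<notin> I" if "j \<in> {1..i}" for j
      using I[OF that] iff[OF lm] by auto
    hence "disc \<epsilon> x I i k = 0" by (simp add: disc_def)
    thus ?thesis using S by simp
  qed
qed auto

text \<open>Two bad events of probability at most \<open>\<delta> / 2\<close> each: a collision,
  which concerns the points alone, and a failure of the walk, bounded for every fixed sample and
  then integrated over the samples.\<close>

lemma failure_probability_le:
  assumes p: "cube_distribution d p" and d: "d \<ge> 1" and M: "Suc (2 * M) < 2^H" "M > 0"
    and H: "H > 0" and \<kappa>: "\<kappa> \<ge> 1" and l: "l > 0"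
    and small1: "real t * (real t * real d) / real M \<le> \<delta> / 2"
    and small2: "real t * (2 * exp (- \<kappa> / 2))
      + real t * (real d * (2^H * (2 * exp (- l\<^sup>2 / (2 * \<kappa> * real H))))) \<le> \<delta> / 2"
    and b: "2 * (sqrt (real d * real H) * l) \<le> b"
  shows "measure (run_space p t)
    {(x, \<omega>) \<in> space (run_space p t). \<forall>I. is_interval I \<and> I \<subseteq> {0..1} \<longrightarrow>
       (\<forall>i\<in>{1..t}. \<forall>k\<in>{1..d}. disc (chosen_sign (balancing_sign d H M \<kappa> p) x \<omega>) x I i k \<le> b)}
    \<ge> 1 - \<delta>"
proof -
  let ?P = "PiM {1..t} (\<lambda>_. p)" and ?R = "run_space p t"
  let ?A = "balancing_sign d H M \<kappa> p"
  let ?K = "\<lambda>x. feature_kernel d H (code M p x)"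
  let ?S = "sqrt (real d * real H) * l"
  have S: "?S \<ge> 0" using l by simp
  have b0: "b \<ge> 0" using b S by linarith
  interpret p: prob_space p using p by (simp add: cube_distribution_def)
  interpret P: prob_space ?P by (intro prob_space_PiM p.prob_space_axioms)
  interpret coins: prob_space coins by (rule prob_space_coins)
  interpret PC: pair_prob_space ?P coins ..
  interpret R: prob_space ?R
    unfolding run_space_def by (rule PC.prob_space_axioms)
  have space_R: "space ?R = space ?P \<times> space coins"
    by (simp add: run_space_def space_pair_measure)

  define B1 where "B1 = {x \<in> space ?P. \<exists>i\<in>{1..t}. \<exists>j\<in>{1..t}. \<exists>k\<in>{1..d}.
      code M p x j k = code M p x i k \<and> x j k \<noteq> x i k}"
  define Q where "Q x \<omega> \<longleftrightarrow> (\<forall>i\<in>{1..t}. \<bar>drift (?K x) \<kappa> \<omega> i\<bar> \<le> \<kappa> \<and>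
      (\<forall>k\<in>{1..d}. \<forall>m\<in>{..<2^H}.
         \<bar>\<Sum>j=1..i. walk (?K x) \<kappa> \<omega> j * (if code M p x j k < m then 1 else 0)\<bar> \<le> ?S))" for x \<omega>
  define B2 where "B2 = {z \<in> space ?R. \<not> Q (fst z) (snd z)}"
  define E where "E = {(x, \<omega>) \<in> space ?R. \<forall>I. is_interval I \<and> I \<subseteq> {0..1} \<longrightarrow>
       (\<forall>i\<in>{1..t}. \<forall>k\<in>{1..d}. disc (chosen_sign ?A x \<omega>) x I i k \<le> b)}"

  have B1_sets: "B1 \<in> sets ?P"
  proof -
    have "B1 = (\<Union>i\<in>{1..t}. \<Union>j\<in>{1..t}. \<Union>k\<in>{1..d}.
        {x \<in> space ?P. code M p x j k = code M p x i k \<and> x j k \<noteq> x i k})"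
      unfolding B1_def by blast
    also have "\<dots> \<in> sets ?P"
      by (intro sets.finite_UN collision_sets[OF p]) auto
    finally show ?thesis .
  qed

  have drift_meas [measurable]: "(\<lambda>z. drift (?K (fst z)) \<kappa> (snd z) i) \<in> borel_measurable ?R"
    if "i \<in> {1..t}" for i
    by (rule drift_measurable[of t]) (use that in \<open>auto intro!: feature_kernel_measurable_run[OF p] coin_measurable_run\<close>)
  have walk_meas [measurable]: "(\<lambda>z. walk (?K (fst z)) \<kappa> (snd z) i) \<in> borel_measurable ?R"
    if "i \<in> {1..t}" for i
    by (rule walk_measurable[of t]) (use that in \<open>auto intro!: feature_kernel_measurable_run[OF p] coin_measurable_run\<close>)
  have below_meas: "(\<lambda>z. if code M p (fst z) j k < m then 1 else 0 :: real) \<in> borel_measurable ?R"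
    if "j \<in> {1..t}" "k \<in> {1..d}" for j k m
    using measurable_compose[OF code_measurable_run[OF p that(2,1), of M],
        of "\<lambda>c. if c < m then 1 else 0 :: real" borel] by simp
  have B2_sets: "B2 \<in> sets ?R"
  proof -
    have "{z \<in> space ?R. \<bar>drift (?K (fst z)) \<kappa> (snd z) i\<bar> \<le> \<kappa>} \<in> sets ?R"
      if "i \<in> {1..t}" for i
      using that by measurable
    moreover have "{z \<in> space ?R.
        \<bar>\<Sum>j=1..i. walk (?K (fst z)) \<kappa> (snd z) j * (if code M p (fst z) j k < m then 1 else 0)\<bar> \<le> ?S} \<in> sets ?R"
      if "i \<in> {1..t}" "k \<in> {1..d}" for i k m
    proof -
      have [measurable]: "(\<lambda>z. \<Sum>j=1..i. walk (?K (fst z)) \<kappa> (snd z) j * (if code M p (fst z) j k < m then 1 else 0))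
          \<in> borel_measurable ?R"
        by (intro borel_measurable_sum borel_measurable_times walk_meas below_meas) (use that in auto)
      show ?thesis by measurable
    qed
    ultimately have "{z \<in> space ?R. Q (fst z) (snd z)} \<in> sets ?R"
      unfolding Q_def
      by (intro sets.sets_Collect_finite_All sets.sets_Collect_conj finite_atLeastAtMost finite_lessThan)
    thus ?thesis
      unfolding B2_def by (rule sets.sets_Collect_neg)
  qed

  have cube: "x j k \<in> {0..1}" if "x \<in> space ?P" "j \<in> {1..t}" "k \<in> {1..d}" for x j k
  proof -
    have "x j \<in> space p" using that by (auto simp: space_PiM)
    thus ?thesis using cube_coordinate_bounds[OF p that(3)] by blast
  qed
  have E_sets: "E \<in> sets ?R"
  proof -
    let ?T = "\<lambda>z i k l m. \<bar>\<Sum>j=1..i. chosen_sign ?A (fst z) (snd z) j *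
        (if fst z l k \<le> fst z j k \<and> fst z j k \<le> fst z m k then 1 else 0)\<bar>"
    have "E = {z \<in> space ?R. \<forall>i\<in>{1..t}. \<forall>k\<in>{1..d}. \<forall>l\<in>{1..i}. \<forall>m\<in>{1..i}. ?T z i k l m \<le> b}"
    proof (rule set_eqI)
      fix z :: "(nat \<Rightarrow> nat \<Rightarrow> real) \<times> (nat \<Rightarrow> real)"
      have "(\<forall>I. is_interval I \<and> I \<subseteq> {0..1} \<longrightarrow> disc (chosen_sign ?A (fst z) (snd z)) (fst z) I i k \<le> b)
          \<longleftrightarrow> (\<forall>l\<in>{1..i}. \<forall>m\<in>{1..i}. ?T z i k l m \<le> b)"
        if "z \<in> space ?R" "i \<in> {1..t}" "k \<in> {1..d}" for i k
        by (rule disc_intervals_iff) (use that cube b0 in \<open>auto simp: space_R\<close>)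
      note iff = this
      have "z \<in> E \<longleftrightarrow> z \<in> space ?R \<and> (\<forall>i\<in>{1..t}. \<forall>k\<in>{1..d}. \<forall>I. is_interval I \<and> I \<subseteq> {0..1} \<longrightarrow>
          disc (chosen_sign ?A (fst z) (snd z)) (fst z) I i k \<le> b)"
        unfolding E_def case_prod_beta mem_Collect_eq prod.collapse by blast
      also have "\<dots> \<longleftrightarrow> z \<in> space ?R \<and> (\<forall>i\<in>{1..t}. \<forall>k\<in>{1..d}. \<forall>l\<in>{1..i}. \<forall>m\<in>{1..i}. ?T z i k l m \<le> b)"
        by (intro conj_cong ball_cong refl iff)
      finally show "z \<in> E \<longleftrightarrow> z \<in> {z \<in> space ?R. \<forall>i\<in>{1..t}. \<forall>k\<in>{1..d}. \<forall>l\<in>{1..i}. \<forall>m\<in>{1..i}. ?T z i k l m \<le> b}"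
        by (simp only: mem_Collect_eq)
    qed
    also have "\<dots> \<in> sets ?R"
    proof (intro sets.sets_Collect_finite_All finite_atLeastAtMost)
      fix i k l m assume "i \<in> {1..t}" "k \<in> {1..d}" "l \<in> {1..i}" "m \<in> {1..i}"
      hence lm: "i \<in> {1..t}" "k \<in> {1..d}" "l \<in> {1..t}" "m \<in> {1..t}" by auto
      have "(\<lambda>z. ?T z i k l m) \<in> borel_measurable ?R"
      proof (intro borel_measurable_abs borel_measurable_sum borel_measurable_times
          chosen_sign_measurable[OF online_balancing_sign[OF p]])
        fix j assume j: "j \<in> {1..i}"
        thus "j \<in> {1..t}" using lm by auto
        hence [measurable]: "(\<lambda>z. fst z j k) \<in> borel_measurable ?R" "(\<lambda>z. fst z l k) \<in> borel_measurable ?R"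
          "(\<lambda>z. fst z m k) \<in> borel_measurable ?R"
          using lm by (auto intro!: coordinate_measurable_run[OF p])
        show "(\<lambda>z. if fst z l k \<le> fst z j k \<and> fst z j k \<le> fst z m k then 1 else 0 :: real) \<in> borel_measurable ?R"
          by measurable
      qed
      thus "{z \<in> space ?R. ?T z i k l m \<le> b} \<in> sets ?R"
        by measurable
    qed
    finally show ?thesis .
  qed

  have code_lt: "code M p x j k < 2^H" if "k \<in> {1..d}" for x j k
    using cell_le[OF prob_space_marginal[OF p that] sets_marginal, of M "x j k"] M
    by (simp add: code_def)

  \<comment> \<open>Outside both events all drifts are bounded, so the signs put out are those of
    the walk, and prefix bounds pass to intervals because nothing collides.\<close>
  have "space ?R - (B1 \<times> space coins \<union> B2) \<subseteq> E"
  proof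
    fix z assume z: "z \<in> space ?R - (B1 \<times> space coins \<union> B2)"
    obtain x \<omega> where x\<omega>: "z = (x, \<omega>)" by (cases z)
    have x: "x \<in> space ?P" "x \<notin> B1" and Q: "Q x \<omega>"
      using z by (auto simp: x\<omega> space_R B2_def)
    show "z \<in> E"
      unfolding x\<omega> E_def
    proof (clarify, intro conjI allI impI ballI; (elim conjE)?)
      show "(x, \<omega>) \<in> space ?R" using z x\<omega> by simp
      fix I :: "real set" and i k
      assume I: "is_interval I" and ik: "i \<in> {1..t}" "k \<in> {1..d}"
      have sign: "chosen_sign ?A x \<omega> j = walk (?K x) \<kappa> \<omega> j" if "j \<in> {1..i}" for j
        by (rule chosen_balancing_sign) (use Q that ik in \<open>auto simp: Q_def\<close>)
      have "disc (chosen_sign ?A x \<omega>) x I i k \<le> 2 * ?S"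
      proof (rule disc_le_of_prefix_bounds[OF p ik(2,1) I M(1) S])
        show "x j k = x l k" if "l \<in> {1..t}" "j \<in> {1..t}" "code M p x j k = code M p x l k" for l j
          using x that ik unfolding B1_def by blast
        fix m :: nat assume "m < 2^H"
        hence "\<bar>\<Sum>j=1..i. walk (?K x) \<kappa> \<omega> j * (if code M p x j k < m then 1 else 0)\<bar> \<le> ?S"
          using Q ik unfolding Q_def by blast
        also have "(\<Sum>j=1..i. walk (?K x) \<kappa> \<omega> j * (if code M p x j k < m then 1 else 0))
            = (\<Sum>j=1..i. chosen_sign ?A x \<omega> j * (if code M p x j k < m then 1 else 0))"
          by (intro sum.cong) (simp_all only: sign)
        finally show "\<bar>\<Sum>j=1..i. chosen_sign ?A x \<omega> j * (if code M p x j k < m then 1 else 0)\<bar> \<le> ?S" .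
      qed
      thus "disc (chosen_sign ?A x \<omega>) x I i k \<le> b" using b by linarith
    qed
  qed
  hence "measure ?R (space ?R - (B1 \<times> space coins \<union> B2)) \<le> measure ?R E"
    using E_sets by (rule R.finite_measure_mono)
  moreover have B1R: "B1 \<times> space coins \<in> sets ?R"
    unfolding run_space_def using B1_sets by (intro pair_measureI) auto
  hence "measure ?R (space ?R - (B1 \<times> space coins \<union> B2)) = 1 - measure ?R (B1 \<times> space coins \<union> B2)"
    using B2_sets by (intro R.prob_compl) auto
  moreover have "measure ?R (B1 \<times> space coins \<union> B2) \<le> measure ?R (B1 \<times> space coins) + measure ?R B2"
    using B1R B2_sets by (rule measure_Un_le)
  moreover have "measure ?R (B1 \<times> space coins) \<le> \<delta> / 2"
  proof -
    have "measure ?R (B1 \<times> space coins) = measure ?P B1"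
      unfolding run_space_def using B1_sets
      by (simp add: measure_def coins.emeasure_pair_measure_Times coins.emeasure_space_1)
    also have "\<dots> \<le> real t * (real t * real d) / real M"
      unfolding B1_def by (rule collision_le[OF p M(2)])
    finally show ?thesis using small1 by linarith
  qed
  moreover have "measure ?R B2 \<le> \<delta> / 2"
  proof -
    \<comment> \<open>The left side of \<open>small1\<close> is nonnegative; this allows the final
      bound by \<open>ennreal (\<delta> / 2)\<close> to be read in the reals.\<close>
    have \<delta>: "\<delta> / 2 \<ge> 0" using small1 by (rule order_trans[rotated]) simp
    \<comment> \<open>Points and coins are independent, so it suffices to bound the section of
      \<open>B2\<close> over each fixed sample.\<close>
    have "emeasure ?R B2 = (\<integral>\<^sup>+x. emeasure coins (Pair x -` B2) \<partial>?P)"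
      using B2_sets unfolding run_space_def by (rule coins.emeasure_pair_measure_alt)
    also have "\<dots> \<le> (\<integral>\<^sup>+x. ennreal (\<delta> / 2) \<partial>?P)"
    proof (rule nn_integral_mono)
      fix x assume "x \<in> space ?P"
      hence "Pair x -` B2 = {\<omega> \<in> space coins. \<not> Q x \<omega>}"
        by (auto simp: B2_def space_R)
      also have "measure coins \<dots> \<le> real t * (2 * exp (- \<kappa> / 2))
          + real t * (real d * (2^H * (2 * exp (- l\<^sup>2 / (2 * \<kappa> * real H)))))"
        unfolding Q_def by (rule walk_prefix_bound) (use code_lt \<kappa> l H d in auto)
      finally show "emeasure coins (Pair x -` B2) \<le> ennreal (\<delta> / 2)"
        unfolding coins.emeasure_eq_measure using small2 by (intro ennreal_leI) linarith
    qed
    also have "\<dots> = ennreal (\<delta> / 2)"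
      by (simp add: P.emeasure_space_1 del: One_nat_def)
    finally show ?thesis
      unfolding R.emeasure_eq_measure using \<delta> by simp
  qed
  ultimately have "measure ?R E \<ge> 1 - \<delta>" by linarith
  thus ?thesis by (simp only: E_def)
qed

section \<open>Choice of the number of levels, the scale of the walk and the tail threshold\<close>

theorem theorem3p1:
  "\<exists>C::real. C > 0 \<and>
    (\<exists>Alg :: nat \<Rightarrow> nat \<Rightarrow> real \<Rightarrow> (nat \<Rightarrow> real) measure \<Rightarrow> strategy.
      \<forall>(d::nat) (t::nat) (\<delta>::real) (p :: (nat \<Rightarrow> real) measure).
        d \<ge> 1 \<longrightarrow> t \<ge> 1 \<longrightarrow> 0 < \<delta> \<longrightarrow> \<delta> < 1 \<longrightarrow> real d * real t / \<delta> \<ge> 2 \<longrightarrow>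
        cube_distribution d p \<longrightarrow>
          online_strategy p t (Alg d t \<delta> p) \<and>
          measure (run_space p t)
            {(x, \<omega>) \<in> space (run_space p t).
               \<forall>I. is_interval I \<and> I \<subseteq> {0..1} \<longrightarrow>
                 (\<forall>i\<in>{1..t}. \<forall>k\<in>{1..d}.
                    disc (chosen_sign (Alg d t \<delta> p) x \<omega>) x I i k
                      \<le> C * sqrt (real d) * (ln (real d * real t / \<delta>))\<^sup>2)}
            \<ge> 1 - \<delta>)"
proof -
  define L :: "nat \<Rightarrow> nat \<Rightarrow> real \<Rightarrow> real" where "L d t \<delta> = ln (real d * real t / \<delta>)" for d t \<delta>
  \<comment> \<open>With \<open>X = d * t / \<delta>\<close>, the factor 10 gives
    \<open>X ^ 6 \<le> 2 ^ H\<close>, because \<open>ln 2 \<ge> 2/3\<close>.\<close>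
  define H where "H d t \<delta> = nat \<lceil>10 * L d t \<delta>\<rceil>" for d t \<delta>
  \<comment> \<open>\<open>M\<close> is a quarter of \<open>2 ^ H\<close>, so that prefixes up to
    \<open>Suc (2 * M)\<close> fit; the scale \<open>8 * L\<close> makes
    \<open>exp (- \<kappa> / 2)\<close> the inverse of \<open>X ^ 4\<close>.\<close>
  define Alg where "Alg d t \<delta> p = balancing_sign d (H d t \<delta>) (2 ^ (H d t \<delta> - 2)) (8 * L d t \<delta>) p"
    for d t \<delta> p
  have main: "1 - \<delta> \<le> measure (run_space p t)
      {(x, \<omega>) \<in> space (run_space p t). \<forall>I. is_interval I \<and> I \<subseteq> {0..1} \<longrightarrow>
         (\<forall>i\<in>{1..t}. \<forall>k\<in>{1..d}. disc (chosen_sign (Alg d t \<delta> p) x \<omega>) x I i k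
            \<le> 384 * sqrt (real d) * (ln (real d * real t / \<delta>))\<^sup>2)}"
    if d: "d \<ge> 1" and t: "t \<ge> 1" and \<delta>: "0 < \<delta>" "\<delta> < 1" and X2: "real d * real t / \<delta> \<ge> 2"
      and p: "cube_distribution d p" for d t \<delta> p
  proof -
    define X where "X = real d * real t / \<delta>"
    define h where "h = H d t \<delta>"
    define \<Lambda> where "\<Lambda> = ln X"
    have X: "X \<ge> 2" using X2 by (simp add: X_def)
    have expL: "exp \<Lambda> = X" using X by (simp add: \<Lambda>_def)
    have "ln 2 \<le> \<Lambda>" using X by (simp add: \<Lambda>_def)
    hence \<Lambda>: "\<Lambda> \<ge> 2/3" using ln2_ge_two_thirds by linarith
    \<comment> \<open>Rounding up adds less than 1, which is at most
      \<open>2 * \<Lambda>\<close>.\<close>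
    have h: "10 * \<Lambda> \<le> real h" "real h \<le> 12 * \<Lambda>"
      using \<Lambda> by (auto simp: h_def H_def L_def \<Lambda>_def X_def) linarith+
    hence h2: "h \<ge> 2" using \<Lambda> by linarith
    have exp_pow: "exp (real n * \<Lambda>) = X ^ n" for n
      by (simp add: exp_of_nat_mult expL)
    have pow: "X ^ 6 \<le> 2 ^ h"
    proof -
      have "X ^ 6 = exp (6 * \<Lambda>)" using exp_pow[of 6] by simp
      also have "6 * \<Lambda> \<le> real h * ln 2"
      proof -
        have "6 * \<Lambda> \<le> real h * (2/3)" using h \<Lambda> by linarith
        also have "\<dots> \<le> real h * ln 2" using ln2_ge_two_thirds by (intro mult_left_mono) auto
        finally show ?thesis .
      qed
      also have "exp (real h * ln 2) = 2 ^ h" by (simp add: exp_of_nat_mult)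
      finally show ?thesis by simp
    qed
    define M :: nat where "M = 2 ^ (h - 2)"
    have M4: "4 * M = 2 ^ h"
    proof -
      have "h = Suc (Suc (h - 2))" using h2 by simp
      hence "(2::nat) ^ h = 2 ^ Suc (Suc (h - 2))" by simp
      thus ?thesis by (simp add: M_def)
    qed
    have M_pos: "M > 0" by (simp add: M_def)
    \<comment> \<open>This extracts the factor \<open>\<delta>\<close> from the union bounds; powers
      of \<open>X\<close> remain.\<close>
    have td: "real t * real d = X * \<delta>" using \<delta> by (simp add: X_def)
    have t_le: "real t \<le> X * \<delta>"
      unfolding td[symmetric] using d mult_left_mono[of 1 "real d" "real t"] by simp
    have t_le': "real t \<le> X"
      using t_le \<delta> X mult_left_mono[of \<delta> 1 X] by linarith
    \<comment> \<open>The value 8 turns \<open>2 / X ^ 3\<close> into at most 1/4, so each of the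
      two walk terms is at most \<open>\<delta> / 4\<close>.\<close>
    have X3: "X ^ 3 \<ge> 8" using power_mono[of 2 X 3] X by simp
    have "measure (run_space p t)
      {(x, \<omega>) \<in> space (run_space p t). \<forall>I. is_interval I \<and> I \<subseteq> {0..1} \<longrightarrow>
         (\<forall>i\<in>{1..t}. \<forall>k\<in>{1..d}. disc (chosen_sign (balancing_sign d h M (8 * \<Lambda>) p) x \<omega>) x I i k
            \<le> 384 * sqrt (real d) * \<Lambda>\<^sup>2)} \<ge> 1 - \<delta>"
    \<comment> \<open>This \<open>l\<close> makes \<open>l\<^sup>2 / (2 * \<kappa> * h)\<close>
      equal to \<open>16 * \<Lambda>\<close>; against the factor
      \<open>2 ^ h \<le> exp (12 * \<Lambda>)\<close> for the prefixes,
      \<open>exp (- 4 * \<Lambda>)\<close> is left.\<close>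
    proof (rule failure_probability_le[OF p d _ M_pos, where l = "16 * \<Lambda> * sqrt (real h)"])
      show "Suc (2 * M) < 2 ^ h" using M4 M_pos by linarith
      show "0 < h" using h2 by simp
      show "1 \<le> 8 * \<Lambda>" using \<Lambda> by simp
      show "0 < 16 * \<Lambda> * sqrt (real h)" using \<Lambda> h2 by simp
      show "real t * (real t * real d) / real M \<le> \<delta> / 2"
      proof -
        have "real t * (real t * real d) \<le> X * (X * \<delta>)"
          unfolding td using t_le' X \<delta> by (intro mult_right_mono) auto
        also have "\<dots> \<le> (X ^ 6 / 8) * \<delta>"
        proof -
          have "X * X * 8 \<le> X * X * (X * X ^ 3)"
            using X X3 by (intro mult_left_mono) (use X3 mult_mono[of 1 X 8 "X ^ 3"] in auto)
          hence "X * X \<le> X ^ 6 / 8" by (simp add: eval_nat_numeral)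
          hence "X * X * \<delta> \<le> (X ^ 6 / 8) * \<delta>" using \<delta> by (intro mult_right_mono) auto
          thus ?thesis by (simp add: mult.assoc)
        qed
        also have "\<dots> \<le> (2 ^ h / 8) * \<delta>"
          using pow \<delta> by (intro mult_right_mono) auto
        also have "(2::real) ^ h = 4 * real M"
          using arg_cong[OF M4, of real] by simp
        finally show ?thesis using M_pos by (simp add: field_simps)
      qed
      show "real t * (2 * exp (- (8 * \<Lambda>) / 2)) + real t * (real d * (2 ^ h *
          (2 * exp (- (16 * \<Lambda> * sqrt (real h))\<^sup>2 / (2 * (8 * \<Lambda>) * real h))))) \<le> \<delta> / 2"
      proof -
        have e4: "exp (- (4 * \<Lambda>)) = 1 / X ^ 4"
          using exp_pow[of 4] by (simp add: exp_minus field_simps)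
        have frac: "X * \<delta> * (2 * (1 / X ^ 4)) \<le> \<delta> / 4"
        proof -
          have "X * \<delta> * (2 * (1 / X ^ 4)) = \<delta> * (2 / X ^ 3)"
            using X by (simp add: eval_nat_numeral)
          also have "2 / X ^ 3 \<le> 1 / 4" using frac_le[of 2 2 8 "X ^ 3"] X3 by simp
          finally show ?thesis using \<delta> by simp
        qed
        have 1: "real t * (2 * exp (- (8 * \<Lambda>) / 2)) \<le> \<delta> / 4"
        proof -
          have "real t * (2 * exp (- (8 * \<Lambda>) / 2)) = real t * (2 * (1 / X ^ 4))"
            using e4 by simp
          also have "\<dots> \<le> X * \<delta> * (2 * (1 / X ^ 4))"
            using t_le X by (intro mult_right_mono) auto
          finally show ?thesis using frac by linarith
        qed
        have "(16 * \<Lambda> * sqrt (real h))\<^sup>2 / (2 * (8 * \<Lambda>) * real h) = 16 * \<Lambda>"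
          using \<Lambda> h2 by (simp add: power_mult_distrib power2_eq_square field_simps)
        moreover have "(2::real) ^ h * exp (- (16 * \<Lambda>)) \<le> 1 / X ^ 4"
        proof -
          have "(2::real) ^ h \<le> exp 1 ^ h"
            by (intro power_mono) (use exp_ge_add_one_self[of 1] in auto)
          also have "\<dots> = exp (real h)" by (simp flip: exp_of_nat_mult)
          also have "\<dots> \<le> exp (12 * \<Lambda>)" using h by simp
          finally have "(2::real) ^ h * exp (- (16 * \<Lambda>)) \<le> exp (12 * \<Lambda>) * exp (- (16 * \<Lambda>))"
            by (intro mult_right_mono) auto
          also have "\<dots> = exp (- (4 * \<Lambda>))" by (simp flip: exp_add)
          finally show ?thesis using e4 by simp
        qed
        hence "X * \<delta> * (2 * (2 ^ h * exp (- (16 * \<Lambda>)))) \<le> X * \<delta> * (2 * (1 / X ^ 4))"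
          using X \<delta> by (intro mult_left_mono) auto
        ultimately have "real t * (real d * (2 ^ h *
          (2 * exp (- (16 * \<Lambda> * sqrt (real h))\<^sup>2 / (2 * (8 * \<Lambda>) * real h))))) \<le> \<delta> / 4"
          using frac unfolding td[symmetric] minus_divide_left[symmetric] by (simp only: mult_ac)
        thus ?thesis using 1 by linarith
      qed
      \<comment> \<open>The constant is \<open>384 = 2 * 16 * 12\<close>: two prefixes per interval,
        the factor in \<open>l\<close>, and \<open>h \<le> 12 * \<Lambda>\<close>.\<close>
      show "2 * (sqrt (real d * real h) * (16 * \<Lambda> * sqrt (real h))) \<le> 384 * sqrt (real d) * \<Lambda>\<^sup>2"
      proof -
        have "2 * (sqrt (real d * real h) * (16 * \<Lambda> * sqrt (real h)))
            = 32 * sqrt (real d) * \<Lambda> * (sqrt (real h) * sqrt (real h))"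
          by (simp only: real_sqrt_mult mult_ac)
        also have "\<dots> = 32 * sqrt (real d) * \<Lambda> * real h" by simp
        also have "\<dots> \<le> 32 * sqrt (real d) * \<Lambda> * (12 * \<Lambda>)"
          using h \<Lambda> by (intro mult_left_mono) auto
        finally show ?thesis by (simp add: power2_eq_square)
      qed
    qed
    thus ?thesis
      by (simp only: Alg_def L_def h_def M_def \<Lambda>_def X_def)
  qed
  show ?thesis
    by (rule exI[of _ 384], intro conjI exI[of _ Alg] allI impI main)
       (auto simp: Alg_def intro: online_balancing_sign)
qed

end
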